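(* Let $\mathcal{X}\subset L^1$ be a subset with $\mathcal{L}\subset\mathcal{X}$, and let $\rho:\mathcal{X}\to(-\infty,\infty]$ be a dilatation monotone functional with the Fatou property. Define $$\overline{\rho}(X)=\sup_{\pi\in\Pi}\rho(\mathbb{E}[X|\pi]),\qquad X\in L^1.$$ Then $\overline{\rho}$ takes values in $(-\infty,\infty]$, and $\overline{\rho}:L^1\to(-\infty,\infty]$ is the unique extension of $\rho$ to $L^1$ that is dilatation monotone and $\sigma(L^1,\mathcal{L})$ lower semicontinuous. Moreover, $\overline{\rho}$ is law invariant, and it preserves monotonicity, convexity, quasiconvexity and cash-additivity of $\rho$ (that is, for each of these four properties, if $\rho$ has the property on $\mathcal{X}$ then $\overline{\rho}$ has it on $L^1$).
   Context: $(\Omega,\mathcal{F},\mathbb{P})$ is a fixed nonatomic probability space; $L^1$ is the space of integrable random variables modulo a.s. equality; all (in)equalities between random variables are a.s. $\mathcal{L}$ is the space of simple random variables $\sum_{i=1}^n a_i\mathbb{1}_{A_i}$ ($n\in\mathbb{N}$, $a_i\in\mathbb{R}$, $A_i\in\mathcal{F}$). $\Pi$ is the collection of all finite measurable partitions of $\Omega$ whose members have nonzero probability, and $\mathbb{E}[X|\pi]:=\mathbb{E}[X|\sigma(\pi)]$ for $\pi\in\Pi$, where $\sigma(\pi)$ is the $\sigma$-algebra generated by $\pi$; note $\mathbb{E}[X|\pi]\in\mathcal{L}$. $\sigma(L^1,\mathcal{L})$ is the coarsest topology on $L^1$ making $X\mapsto\mathbb{E}[XY]$ continuous for each $Y\in\mathcal{L}$.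 An ideal of $L^1$ is a linear subspace $\mathcal{J}$ such that $X\in L^1$, $|X|\le|Y|$, $Y\in\mathcal{J}$ imply $X\in\mathcal{J}$. $\mathcal{I}(\mathcal{X})$ is the smallest ideal of $L^1$ including $\mathcal{X}$, i.e. the set of $X\in L^1$ with $|X|\le\sum_{i=1}^n\lambda_i|X_i|$ for some $n\in\mathbb{N}$, $X_i\in\mathcal{X}$, $\lambda_i\ge 0$. For a subset $\mathcal{X}\subset L^1$ containing $\mathcal{L}$, a functional $\rho:\mathcal{X}\to[-\infty,\infty]$ is: dilatation monotone if $\rho(\mathbb{E}[X|\pi])\le\rho(X)$ for all $X\in\mathcal{X}$, $\pi\in\Pi$; law invariant if $\rho(X)=\rho(Y)$ whenever $X,Y\in\mathcal{X}$ have the same distribution under $\mathbb{P}$; convex (resp. quasiconvex) if $\rho(\lambda X+(1-\lambda)Y)\le\lambda\rho(X)+(1-\lambda)\rho(Y)$ (resp. $\le\max\{\rho(X),\rho(Y)\}$) for all $X,Y\in\mathcal{X}$, $\lambda\in(0,1)$ with $\lambda X+(1-\lambda)Y\in\mathcal{X}$; cash-additive if $\rho(X+s)=\rho(X)-s$ for all $X\in\mathcal{X}$, $s\in\mathbb{R}$ with $X+s\in\mathcal{X}$; monotone if $\rho(X)\le\rho(Y)$ for all $X,Y\in\mathcal{X}$ with $X\ge Y$. $\rho$ has the Fatou property if for any sequence $(X_n)$ in $\mathcal{X}$ and $X\in\mathcal{X}$, $X_n\to X$ a.s. and $\sup_n|X_n|\in\mathcal{I}(\mathcal{X})$ imply $\rho(X)\le\liminf_n\rho(X_n)$.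 For a topology $\tau$ on $\mathcal{X}$, $\rho$ is $\tau$ lower semicontinuous if $\{X\in\mathcal{X}:\rho(X)\le\lambda\}$ is $\tau$-closed for each $\lambda\in\mathbb{R}$. *)

theory Defs
  imports "HOL-Probability.Probability"
begin

definition nonatomic :: "'a measure \<Rightarrow> bool" where
  "nonatomic M \<longleftrightarrow>
    (\<forall>A\<in>sets M. measure M A > 0 \<longrightarrow>
      (\<exists>B\<in>sets M. B \<subseteq> A \<and> 0 < measure M B \<and> measure M B < measure M A))"

text \<open>
  Random variables modulo almost sure equality are handled through representatives:
  a subset of \<open>L\<^sup>1\<close> is a set of integrable functions that is closed under a.s. equality
  (\<open>L1_subset\<close>), and a functional on such a set is a function that does not distinguish
  a.s. equal representatives (\<open>functional_on\<close>). Only its values on that set matter.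
\<close>

definition L1 :: "'a measure \<Rightarrow> ('a \<Rightarrow> real) set" where
  "L1 M = {X. integrable M X}"

definition simple_rvs :: "'a measure \<Rightarrow> ('a \<Rightarrow> real) set" where
  "simple_rvs M = {X. simple_function M X}"

definition L1_subset :: "'a measure \<Rightarrow> ('a \<Rightarrow> real) set \<Rightarrow> bool" where
  "L1_subset M S \<longleftrightarrow> S \<subseteq> L1 M \<and>
    (\<forall>X\<in>S. \<forall>Y\<in>L1 M. (AE \<omega> in M. X \<omega> = Y \<omega>) \<longrightarrow> Y \<in> S)"

definition functional_on :: "'a measure \<Rightarrow> ('a \<Rightarrow> real) set \<Rightarrow> (('a \<Rightarrow> real) \<Rightarrow> ereal) \<Rightarrow> bool" where
  "functional_on M S \<rho> \<longleftrightarrow>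
    (\<forall>X\<in>S. \<forall>Y\<in>S. (AE \<omega> in M. X \<omega> = Y \<omega>) \<longrightarrow> \<rho> X = \<rho> Y)"

definition finite_partitions :: "'a measure \<Rightarrow> 'a set set set" where
  "finite_partitions M =
    {\<pi>. finite \<pi> \<and> partition_on (space M) \<pi> \<and> (\<forall>A\<in>\<pi>. A \<in> sets M \<and> measure M A \<noteq> 0)}"

definition cexp_partition :: "'a measure \<Rightarrow> 'a set set \<Rightarrow> ('a \<Rightarrow> real) \<Rightarrow> ('a \<Rightarrow> real)" where
  "cexp_partition M \<pi> X = real_cond_exp M (sigma (space M) \<pi>) X"

text \<open>
  The topology generated by the preimages of open sets under the maps \<open>X \<mapsto> E[X Y]\<close>,
  \<open>Y\<close> simple. It lives on representatives; its open sets are closed under a.s. equality, so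
  they correspond to the open sets of the quotient. The lemmas below confirm that it is the
  coarsest topology on \<open>L\<^sup>1\<close> that makes these maps continuous.
\<close>

definition weak_L1_topology :: "'a measure \<Rightarrow> ('a \<Rightarrow> real) topology" where
  "weak_L1_topology M = topology_generated_by
    {{X \<in> L1 M. (\<integral>\<omega>. X \<omega> * Y \<omega> \<partial>M) \<in> U} | Y U. Y \<in> simple_rvs M \<and> open U}"

lemma topspace_weak_L1_topology: "topspace (weak_L1_topology M) = L1 M"
proof -
  have "(\<lambda>_. 0) \<in> simple_rvs M" by (simp add: simple_rvs_def)
  then have "L1 M \<in> {{X \<in> L1 M. (\<integral>\<omega>. X \<omega> * Y \<omega> \<partial>M) \<in> U} | Y U. Y \<in> simple_rvs M \<and> open U}"
    by (intro CollectI exI[of _ "\<lambda>_. 0"] exI[of _ UNIV]) auto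
  then show ?thesis
    unfolding weak_L1_topology_def topology_generated_by_topspace by blast
qed

lemma continuous_map_weak_L1_topology:
  assumes "Y \<in> simple_rvs M"
  shows "continuous_map (weak_L1_topology M) euclideanreal (\<lambda>X. \<integral>\<omega>. X \<omega> * Y \<omega> \<partial>M)"
  unfolding continuous_map_def topspace_weak_L1_topology
  using assms by (auto simp: weak_L1_topology_def intro!: topology_generated_by_Basis)

lemma weak_L1_topology_coarsest:
  assumes top: "topspace T = L1 M"
    and cont: "\<And>Y. Y \<in> simple_rvs M \<Longrightarrow>
      continuous_map T euclideanreal (\<lambda>X. \<integral>\<omega>. X \<omega> * Y \<omega> \<partial>M)"
    and "openin (weak_L1_topology M) S"
  shows "openin T S"
proof -
  have "generate_topology_on
      {{X \<in> L1 M. (\<integral>\<omega>. X \<omega> * Y \<omega> \<partial>M) \<in> U} | Y U. Y \<in> simple_rvs M \<and> open U} S"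
    using assms(3) unfolding weak_L1_topology_def by (rule openin_topology_generated_by)
  then show ?thesis
  proof induction
    case (Basis S)
    then show ?case
      using cont top openin_continuous_map_preimage by fastforce
  qed auto
qed

definition L1_ideal :: "'a measure \<Rightarrow> ('a \<Rightarrow> real) set \<Rightarrow> bool" where
  "L1_ideal M J \<longleftrightarrow> J \<subseteq> L1 M \<and> (\<lambda>_. 0) \<in> J \<and>
    (\<forall>X\<in>J. \<forall>Y\<in>J. (\<lambda>\<omega>. X \<omega> + Y \<omega>) \<in> J) \<and>
    (\<forall>X\<in>J. \<forall>c. (\<lambda>\<omega>. c * X \<omega>) \<in> J) \<and>
    (\<forall>X\<in>L1 M. \<forall>Y\<in>J. (AE \<omega> in M. \<bar>X \<omega>\<bar> \<le> \<bar>Y \<omega>\<bar>) \<longrightarrow> X \<in> J)"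

definition ideal_generated :: "'a measure \<Rightarrow> ('a \<Rightarrow> real) set \<Rightarrow> ('a \<Rightarrow> real) set" where
  "ideal_generated M S = L1_ideal M hull S"

definition dilatation_monotone ::
  "'a measure \<Rightarrow> ('a \<Rightarrow> real) set \<Rightarrow> (('a \<Rightarrow> real) \<Rightarrow> ereal) \<Rightarrow> bool" where
  "dilatation_monotone M S \<rho> \<longleftrightarrow>
    (\<forall>X\<in>S. \<forall>\<pi>\<in>finite_partitions M. \<rho> (cexp_partition M \<pi> X) \<le> \<rho> X)"

definition law_invariant ::
  "'a measure \<Rightarrow> ('a \<Rightarrow> real) set \<Rightarrow> (('a \<Rightarrow> real) \<Rightarrow> ereal) \<Rightarrow> bool" where
  "law_invariant M S \<rho> \<longleftrightarrow>
    (\<forall>X\<in>S. \<forall>Y\<in>S. distr M borel X = distr M borel Y \<longrightarrow> \<rho> X = \<rho> Y)"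

definition convex_functional :: "('a \<Rightarrow> real) set \<Rightarrow> (('a \<Rightarrow> real) \<Rightarrow> ereal) \<Rightarrow> bool" where
  "convex_functional S \<rho> \<longleftrightarrow>
    (\<forall>X\<in>S. \<forall>Y\<in>S. \<forall>l::real. 0 < l \<and> l < 1 \<and> (\<lambda>\<omega>. l * X \<omega> + (1 - l) * Y \<omega>) \<in> S \<longrightarrow>
      \<rho> (\<lambda>\<omega>. l * X \<omega> + (1 - l) * Y \<omega>) \<le> ereal l * \<rho> X + ereal (1 - l) * \<rho> Y)"

definition quasiconvex_functional :: "('a \<Rightarrow> real) set \<Rightarrow> (('a \<Rightarrow> real) \<Rightarrow> ereal) \<Rightarrow> bool" where
  "quasiconvex_functional S \<rho> \<longleftrightarrow>
    (\<forall>X\<in>S. \<forall>Y\<in>S. \<forall>l::real. 0 < l \<and> l < 1 \<and> (\<lambda>\<omega>. l * X \<omega> + (1 - l) * Y \<omega>) \<in> S \<longrightarrow>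
      \<rho> (\<lambda>\<omega>. l * X \<omega> + (1 - l) * Y \<omega>) \<le> max (\<rho> X) (\<rho> Y))"

definition cash_additive :: "('a \<Rightarrow> real) set \<Rightarrow> (('a \<Rightarrow> real) \<Rightarrow> ereal) \<Rightarrow> bool" where
  "cash_additive S \<rho> \<longleftrightarrow>
    (\<forall>X\<in>S. \<forall>s::real. (\<lambda>\<omega>. X \<omega> + s) \<in> S \<longrightarrow> \<rho> (\<lambda>\<omega>. X \<omega> + s) = \<rho> X - ereal s)"

text \<open>Monotonicity follows the convention for risk measures: larger positions have smaller risk.\<close>

definition monotone_functional ::
  "'a measure \<Rightarrow> ('a \<Rightarrow> real) set \<Rightarrow> (('a \<Rightarrow> real) \<Rightarrow> ereal) \<Rightarrow> bool" where
  "monotone_functional M S \<rho> \<longleftrightarrow>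
    (\<forall>X\<in>S. \<forall>Y\<in>S. (AE \<omega> in M. X \<omega> \<ge> Y \<omega>) \<longrightarrow> \<rho> X \<le> \<rho> Y)"

text \<open>
  The supremum of the \<open>\<bar>X\<^sub>n\<bar>\<close> is taken in the extended reals; that it lies in the generated
  ideal means that it is a.s. equal to a (real-valued) member \<open>Z\<close> of the ideal.
\<close>

definition Fatou_property ::
  "'a measure \<Rightarrow> ('a \<Rightarrow> real) set \<Rightarrow> (('a \<Rightarrow> real) \<Rightarrow> ereal) \<Rightarrow> bool" where
  "Fatou_property M S \<rho> \<longleftrightarrow>
    (\<forall>Xs :: nat \<Rightarrow> 'a \<Rightarrow> real. \<forall>X\<in>S. (\<forall>n. Xs n \<in> S) \<longrightarrow>
      (AE \<omega> in M. (\<lambda>n. Xs n \<omega>) \<longlonglongrightarrow> X \<omega>) \<longrightarrow>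
      (\<exists>Z\<in>ideal_generated M S. AE \<omega> in M. (SUP n. ereal \<bar>Xs n \<omega>\<bar>) = ereal (Z \<omega>)) \<longrightarrow>
      \<rho> X \<le> liminf (\<lambda>n. \<rho> (Xs n)))"

definition lsc_functional :: "('a \<Rightarrow> real) topology \<Rightarrow> (('a \<Rightarrow> real) \<Rightarrow> ereal) \<Rightarrow> bool" where
  "lsc_functional T \<rho> \<longleftrightarrow> (\<forall>l::real. closedin T {X \<in> topspace T. \<rho> X \<le> ereal l})"

definition rho_bar ::
  "'a measure \<Rightarrow> (('a \<Rightarrow> real) \<Rightarrow> ereal) \<Rightarrow> ('a \<Rightarrow> real) \<Rightarrow> ereal" where
  "rho_bar M \<rho> X = (SUP \<pi>\<in>finite_partitions M. \<rho> (cexp_partition M \<pi> X))"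

text \<open>An extension to \<open>L\<^sup>1\<close> that is dilatation monotone and lower semicontinuous.\<close>

definition dm_lsc_extension ::
  "'a measure \<Rightarrow> ('a \<Rightarrow> real) set \<Rightarrow> (('a \<Rightarrow> real) \<Rightarrow> ereal) \<Rightarrow> (('a \<Rightarrow> real) \<Rightarrow> ereal) \<Rightarrow> bool" where
  "dm_lsc_extension M S \<rho> \<rho>' \<longleftrightarrow>
    functional_on M (L1 M) \<rho>' \<and> (\<forall>X\<in>S. \<rho>' X = \<rho> X) \<and>
    dilatation_monotone M (L1 M) \<rho>' \<and> lsc_functional (weak_L1_topology M) \<rho>'"

end

theory Submission
  imports Defs
begin

text \<open>
  A member of \<open>S\<close> is an a.s. limit of averages over finite partitions that it dominates up to a
  constant: partition into short level sets of \<open>X\<close> and one remainder cell, which consists of a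
  tail \<open>{\<bar>X\<bar> > N}\<close> and of a set \<open>B\<close> of small probability on which \<open>X\<close> is bounded; if \<open>N\<close> is so
  large that the integral of \<open>\<bar>X\<bar>\<close> over the tail is at most \<open>P(B)\<close>, the average over this cell
  stays bounded. So the Fatou property shows that \<open>rho_bar\<close> extends \<open>\<rho>\<close>. Lower semicontinuity
  follows from the Fatou property because \<open>E[X|\<pi>]\<close> depends on finitely many integrals, and
  uniqueness holds because each weak neighbourhood of \<open>X\<close> contains some \<open>E[X|\<pi>]\<close>.

  For law invariance, averaging can almost interchange the values \<open>x\<close> and \<open>y\<close> of a simple random
  variable on two disjoint sets of equal probability, in the manner of a counter-current heat
  exchanger. With the Fatou property, \<open>\<rho>\<close> does not increase under an exact interchange. Simple random
  variables with the same law differ by finitely many interchanges, and the general case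
  follows by discretisation.
\<close>

section \<open>Conditional expectations given a finite partition\<close>

text \<open>The Fatou property asks for a bound in the generated ideal, and for a general
  \<open>S\<close> only constants and multiples of \<open>\<bar>X\<bar>\<close> are guaranteed
  there. The average of \<open>\<bar>X\<bar>\<close> over the tail alone may exceed the values just
  above the threshold \<open>N\<close> by a factor that is unbounded in \<open>N\<close>, so
  averaging over level sets and the bare tail is not dominated. Mixing \<open>B\<close> into the
  tail caps the average by a constant, and letting the sets \<open>B\<close> decrease to a null set
  preserves a.s. convergence.

  Once a partition is fixed, domination is automatic: the averages are finitely many convergent
  sequences. This is why a sequential property yields semicontinuity for a weak topology, and why
  convergence in the mean suffices at the end of the proof of law invariance.

  An interchange of two distinct values on sets of positive probability is not a conditional
  expectation, since an averaging that changes a simple random variable strictly lowers its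
  variance. It is only reached as a limit of chains of averagings; \<open>t\<close> measures the
  part of the difference that a chain fails to transfer.\<close>

definition set_avg :: "'a measure \<Rightarrow> 'a set \<Rightarrow> ('a \<Rightarrow> real) \<Rightarrow> real" where
  "set_avg M A X = (LINT x:A|M. X x) / measure M A"

text \<open>
  The conditional expectation of \<open>X\<close> given \<open>f\<close>, up to the value \<open>0\<close> on null level sets of \<open>f\<close>.
  Null levels are harmless here, whereas the cells of a member of \<open>finite_partitions\<close> must
  not be null.
\<close>

definition level_avg :: "'a measure \<Rightarrow> ('a \<Rightarrow> 'b) \<Rightarrow> ('a \<Rightarrow> real) \<Rightarrow> 'a \<Rightarrow> real" where
  "level_avg M f X \<omega> = set_avg M (f -` {f \<omega>} \<inter> space M) X"

context prob_space
begin

lemma integrable_simple [intro]: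
  fixes f :: "'a \<Rightarrow> real"
  shows "simple_function M f \<Longrightarrow> integrable M f"
  by (rule integrable_simple_function) (auto simp: emeasure_eq_measure)

lemma set_integrable_L1 [intro]:
  fixes X :: "'a \<Rightarrow> real"
  shows "integrable M X \<Longrightarrow> A \<in> sets M \<Longrightarrow> set_integrable M A X"
  unfolding set_integrable_def by (rule integrable_mult_indicator)

lemma set_integral_const_real: "A \<in> sets M \<Longrightarrow> (LINT x:A|M. (c::real)) = c * prob A"
  by (simp add: set_lebesgue_integral_def)

lemma set_integral_null:
  assumes "A \<in> sets M" "prob A = 0"
  shows "(LINT x:A|M. (X x :: real)) = 0"
proof -
  have "A \<in> null_sets M" using assms by (simp add: null_sets_def emeasure_eq_measure)
  then have "AE x in M. x \<notin> A" by (rule AE_not_in)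
  then have "AE x in M. indicator A x *\<^sub>R X x = 0" by eventually_elim simp
  then show ?thesis unfolding set_lebesgue_integral_def by (rule integral_eq_zero_AE)
qed

lemma set_avg_close:
  assumes "A \<in> sets M" "prob A > 0" "integrable M X" "\<And>\<omega>. \<omega> \<in> A \<Longrightarrow> \<bar>X \<omega> - c\<bar> \<le> e"
  shows "\<bar>set_avg M A X - c\<bar> \<le> e"
proof -
  have i: "set_integrable M A X" "\<And>d. set_integrable M A (\<lambda>_. d::real)" using assms by auto
  have "(LINT x:A|M. c - e) \<le> (LINT x:A|M. X x)" "(LINT x:A|M. X x) \<le> (LINT x:A|M. c + e)"
    using assms(4) by (intro set_integral_mono i; force simp: abs_le_iff)+
  then have "(c - e) * prob A \<le> (LINT x:A|M. X x)" "(LINT x:A|M. X x) \<le> (c + e) * prob A"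
    using assms(1) by (simp_all add: set_integral_const_real)
  then have "c - e \<le> set_avg M A X" "set_avg M A X \<le> c + e"
    unfolding set_avg_def using assms(2) by (simp_all add: pos_le_divide_eq pos_divide_le_eq)
  then show ?thesis by (simp add: abs_le_iff)
qed

lemma set_avg_const:
  assumes "A \<in> sets M" "prob A > 0" "\<And>\<omega>. \<omega> \<in> A \<Longrightarrow> X \<omega> = c"
  shows "set_avg M A X = c"
proof -
  have "(LINT x:A|M. X x) = (LINT x:A|M. c)" using assms by (intro set_lebesgue_integral_cong) auto
  then show ?thesis using assms by (simp add: set_avg_def set_integral_const_real)
qed

text \<open>On a null set both sides vanish: the integral is 0, and so is the quotient, because
  division by zero yields 0.\<close>

lemma set_avg_mult: "A \<in> sets M \<Longrightarrow> set_avg M A X * prob A = (LINT x:A|M. X x)"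
  using set_integral_null[of A X] by (cases "prob A = 0") (auto simp: set_avg_def)

lemma abs_set_avg_le:
  assumes "A \<in> sets M" "integrable M X"
  shows "\<bar>set_avg M A X\<bar> \<le> set_avg M A (\<lambda>x. \<bar>X x\<bar>)"
proof -
  have "\<bar>LINT x:A|M. X x\<bar> \<le> (LINT x:A|M. \<bar>X x\<bar>)"
    using set_integral_norm_bound[OF set_integrable_L1[OF assms(2,1)]] by simp
  then show ?thesis by (simp add: set_avg_def abs_divide divide_right_mono)
qed

lemma finite_partitionsD:
  assumes "\<pi> \<in> finite_partitions M"
  shows "finite \<pi>" "\<Union>\<pi> = space M" "disjoint \<pi>"
    "A \<in> \<pi> \<Longrightarrow> A \<in> sets M" "A \<in> \<pi> \<Longrightarrow> A \<noteq> {}" "A \<in> \<pi> \<Longrightarrow> prob A > 0"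
  using assms by (auto simp: finite_partitions_def partition_on_def zero_less_measure_iff)

lemma subalgebra_partition:
  assumes "\<pi> \<in> finite_partitions M"
  shows "subalgebra M (sigma (space M) \<pi>)" "sets (sigma (space M) \<pi>) = sigma_sets (space M) \<pi>"
proof -
  have s: "\<pi> \<subseteq> Pow (space M)" using finite_partitionsD(2)[OF assms] by auto
  then show "sets (sigma (space M) \<pi>) = sigma_sets (space M) \<pi>" by simp
  then show "subalgebra M (sigma (space M) \<pi>)"
    using s finite_partitionsD(4)[OF assms]
    by (auto simp: subalgebra_def dest: sets.sigma_sets_subset[of \<pi> M, THEN subsetD, rotated])
qed

text \<open>The level sets of a function measurable for the generated sigma-algebra therefore cannot
  cut a cell, so such a function is constant on cells.\<close>

lemma sigma_sets_partition_cell: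
  assumes "B \<in> sigma_sets (space M) \<pi>" "\<pi> \<in> finite_partitions M" "A \<in> \<pi>"
  shows "A \<subseteq> B \<or> A \<inter> B = {}"
  using assms(1)
proof induction
  case (Basic B)
  then show ?case using finite_partitionsD(3)[OF assms(2)] assms(3) by (auto simp: disjoint_def)
next
  case (Compl B)
  then show ?case using finite_partitionsD(2)[OF assms(2)] assms(3) by auto
qed auto

text \<open>The equation holds at every point, not only a.s.: the chosen representative is
  measurable for the sigma-algebra of \<open>\<pi>\<close>, hence constant on \<open>A\<close>, and
  its value is forced by the integral over \<open>A\<close>, which has positive probability.\<close>

lemma cexp_partition_eq:
  assumes \<pi>: "\<pi> \<in> finite_partitions M" and X: "integrable M X" and A: "A \<in> \<pi>" "\<omega> \<in> A"
  shows "cexp_partition M \<pi> X \<omega> = set_avg M A X"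
proof -
  let ?F = "sigma (space M) \<pi>"
  interpret finite_measure_subalgebra M ?F
    by unfold_locales (rule subalgebra_partition(1)[OF \<pi>])
  let ?g = "real_cond_exp M ?F X"
  have "?g \<in> borel_measurable ?F" by simp
  then have "?g -` {?g \<omega>} \<inter> space ?F \<in> sets ?F" by (rule measurable_sets) simp
  then have "?g -` {?g \<omega>} \<inter> space M \<in> sigma_sets (space M) \<pi>"
    by (simp only: subalgebra_partition(2)[OF \<pi>] space_measure_of_conv)
  then have "A \<subseteq> ?g -` {?g \<omega>} \<inter> space M"
    using sigma_sets_partition_cell[OF _ \<pi> A(1)] A finite_partitionsD(2)[OF \<pi>] by fastforce
  then have "set_avg M A ?g = ?g \<omega>"
    using A by (intro set_avg_const finite_partitionsD[OF \<pi>]) auto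
  moreover have "A \<in> sets ?F" using A by (auto simp: subalgebra_partition(2)[OF \<pi>])
  ultimately show ?thesis
    using real_cond_exp_intA[OF X] by (simp add: cexp_partition_def set_avg_def)
qed

lemma partition_cell:
  assumes "\<pi> \<in> finite_partitions M" "\<omega> \<in> space M"
  obtains A where "A \<in> \<pi>" "\<omega> \<in> A"
  using finite_partitionsD(2)[OF assms(1)] assms(2) by blast

lemma simple_cexp:
  assumes \<pi>: "\<pi> \<in> finite_partitions M" and X: "integrable M X"
  shows "simple_function M (cexp_partition M \<pi> X)"
proof (rule simple_function_borel_measurable)
  show "cexp_partition M \<pi> X \<in> borel_measurable M"
    unfolding cexp_partition_def by (rule borel_measurable_cond_exp2)
  have "cexp_partition M \<pi> X ` space M \<subseteq> (\<lambda>A. set_avg M A X) ` \<pi>"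
  proof (rule image_subsetI)
    fix \<omega> assume "\<omega> \<in> space M"
    then obtain A where "A \<in> \<pi>" "\<omega> \<in> A" by (rule partition_cell[OF \<pi>])
    then show "cexp_partition M \<pi> X \<omega> \<in> (\<lambda>A. set_avg M A X) ` \<pi>"
      using cexp_partition_eq[OF \<pi> X] by blast
  qed
  then show "finite (cexp_partition M \<pi> X ` space M)"
    using finite_partitionsD(1)[OF \<pi>] finite_surj by blast
qed

section \<open>Averages over the level sets of a simple function\<close>

lemma simple_level_null:
  assumes f: "simple_function M f"
  shows "AE \<omega> in M. prob (f -` {f \<omega>} \<inter> space M) > 0"
proof -
  let ?N = "{b \<in> f ` space M. prob (f -` {b} \<inter> space M) = 0}"
  have "AE \<omega> in M. \<forall>b\<in>?N. \<omega> \<notin> f -` {b} \<inter> space M"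
  proof (rule AE_finite_allI)
    show "finite ?N" using simple_functionD(1)[OF f] by auto
    fix b assume "b \<in> ?N"
    then have "f -` {b} \<inter> space M \<in> null_sets M"
      using simple_functionD(2)[OF f] by (auto simp: null_sets_def emeasure_eq_measure)
    then show "AE \<omega> in M. \<omega> \<notin> f -` {b} \<inter> space M" by (rule AE_not_in)
  qed
  with AE_space show ?thesis by eventually_elim (auto simp: zero_less_measure_iff)
qed

text \<open>Cells must not be null, so the levels of \<open>f\<close> itself may fail to be a
  partition in the required sense; a change of \<open>f\<close> on a null set repairs this.\<close>

lemma level_partition:
  assumes f: "simple_function M f"
  obtains \<pi> g where "\<pi> \<in> finite_partitions M" "simple_function M g" "AE \<omega> in M. g \<omega> = f \<omega>"
    "\<pi> = (\<lambda>b. g -` {b} \<inter> space M) ` g ` space M"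
proof -
  obtain \<omega>0 where \<omega>0: "\<omega>0 \<in> space M" "prob (f -` {f \<omega>0} \<inter> space M) > 0"
  proof (atomize_elim, rule ccontr)
    assume *: "\<not> (\<exists>\<omega>0. \<omega>0 \<in> space M \<and> 0 < prob (f -` {f \<omega>0} \<inter> space M))"
    then have "\<not> prob (f -` {f \<omega>} \<inter> space M) > 0" if "\<omega> \<in> space M" for \<omega>
      using that by blast
    with simple_level_null[OF f] have "AE \<omega> in M. False" by auto
    then show False by simp
  qed
  define p where "p b = prob (f -` {b} \<inter> space M)" for b
  \<comment> \<open>All null levels are merged into the level of \<open>\<omega>0\<close>, which has
    positive probability.\<close>
  define g where "g \<omega> = (if p (f \<omega>) > 0 then f \<omega> else f \<omega>0)" for \<omega>
  have g: "simple_function M g" unfolding g_def by (rule simple_function_compose1[OF f])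
  have AE: "AE \<omega> in M. g \<omega> = f \<omega>"
    using simple_level_null[OF f] by eventually_elim (simp add: g_def p_def)
  define \<pi> where "\<pi> = (\<lambda>b. g -` {b} \<inter> space M) ` g ` space M"
  have "prob (g -` {b} \<inter> space M) > 0" if "b \<in> g ` space M" for b
  proof -
    have "p b > 0" using that \<omega>0(2) by (auto simp: g_def p_def split: if_splits)
    moreover have "f -` {b} \<inter> space M \<subseteq> g -` {b} \<inter> space M"
      using \<open>p b > 0\<close> by (auto simp: g_def)
    ultimately show ?thesis unfolding p_def
      using finite_measure_mono[OF _ simple_functionD(2)[OF g]] by (meson less_le_trans)
  qed
  then have "A \<in> sets M \<and> prob A \<noteq> 0" if "A \<in> \<pi>" for A
    using that simple_functionD(2)[OF g] unfolding \<pi>_def by fastforce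
  moreover have "partition_on (space M) \<pi>"
    unfolding \<pi>_def by (rule partition_onI) (auto simp: disjnt_def)
  moreover have "finite \<pi>" using simple_functionD(1)[OF g] by (simp add: \<pi>_def)
  ultimately have "\<pi> \<in> finite_partitions M"
    unfolding finite_partitions_def by blast
  then show ?thesis using that g AE \<pi>_def by blast
qed

lemma set_avg_level_cong_AE:
  assumes "simple_function M f" "simple_function M g" "AE \<omega> in M. g \<omega> = f \<omega>" "integrable M X"
  shows "set_avg M (g -` {b} \<inter> space M) X = set_avg M (f -` {b} \<inter> space M) X"
proof -
  have "prob (g -` {b} \<inter> space M) = prob (f -` {b} \<inter> space M)"
    using assms by (intro finite_measure_eq_AE simple_functionD(2)) auto
  moreover have "(LINT x:g -` {b} \<inter> space M|M. X x) = (LINT x:f -` {b} \<inter> space M|M. X x)"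
    using assms
    by (intro set_integral_cong_set) (auto simp: set_borel_measurable_def simple_functionD(2)
        intro!: borel_measurable_times borel_measurable_indicator)
  ultimately show ?thesis by (simp add: set_avg_def)
qed

text \<open>This is the bridge by which dilatation monotonicity becomes available for averages over
  the levels of an arbitrary simple function.\<close>

lemma cexp_level_avg:
  assumes f: "simple_function M f"
  obtains \<pi> where "\<pi> \<in> finite_partitions M"
    "\<forall>X. integrable M X \<longrightarrow> (AE \<omega> in M. cexp_partition M \<pi> X \<omega> = level_avg M f X \<omega>)"
proof -
  obtain \<pi> g where \<pi>: "\<pi> \<in> finite_partitions M" and g: "simple_function M g"
    and AE: "AE \<omega> in M. g \<omega> = f \<omega>" and eq: "\<pi> = (\<lambda>b. g -` {b} \<inter> space M) ` g ` space M"
    using level_partition[OF f] .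
  show ?thesis
  proof (rule that[OF \<pi>], intro allI impI)
    fix X :: "'a \<Rightarrow> real" assume X: "integrable M X"
    show "AE \<omega> in M. cexp_partition M \<pi> X \<omega> = level_avg M f X \<omega>"
      using AE AE_space
    proof eventually_elim
      case (elim \<omega>)
      then have \<omega>: "\<omega> \<in> space M" by simp
      then have "cexp_partition M \<pi> X \<omega> = set_avg M (g -` {g \<omega>} \<inter> space M) X"
        by (intro cexp_partition_eq[OF \<pi> X]) (use eq in \<open>blast, blast\<close>)
      then show ?case using elim set_avg_level_cong_AE[OF f g AE X] by (simp add: level_avg_def)
    qed
  qed
qed

lemma simple_level_avg: "simple_function M f \<Longrightarrow> simple_function M (level_avg M f X)"
  unfolding level_avg_def by (rule simple_function_compose1[where g="\<lambda>b. set_avg M (f -` {b} \<inter> space M) X"])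

text \<open>The bound \<open>e\<close> is quantified inside \<open>AE\<close> because it may depend
  on the point: it is used on the short level sets and not on the remainder cell.\<close>

lemma AE_level_avg_close:
  assumes f: "simple_function M f" and X: "integrable M X"
  shows "AE \<omega> in M. \<forall>e. (\<forall>\<omega>'\<in>space M. f \<omega>' = f \<omega> \<longrightarrow> \<bar>X \<omega>' - X \<omega>\<bar> \<le> e) \<longrightarrow>
    \<bar>level_avg M f X \<omega> - X \<omega>\<bar> \<le> e"
  using simple_level_null[OF f]
proof eventually_elim
  case (elim \<omega>)
  then show ?case unfolding level_avg_def
    using simple_functionD(2)[OF f] X by (auto intro!: set_avg_close)
qed

lemma set_integral_levels:
  fixes Z :: "'a \<Rightarrow> real"
  assumes f: "simple_function M f" and Z: "integrable M Z"
  shows "(\<integral>\<omega>. Z \<omega> \<partial>M) = (\<Sum>b\<in>f ` space M. LINT \<omega>:f -` {b} \<inter> space M|M. Z \<omega>)"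
proof -
  have "(\<integral>\<omega>. Z \<omega> \<partial>M) = (\<integral>\<omega>. (\<Sum>b\<in>f ` space M. indicator (f -` {b} \<inter> space M) \<omega> *\<^sub>R Z \<omega>) \<partial>M)"
  proof (rule Bochner_Integration.integral_cong)
    fix \<omega> assume \<omega>: "\<omega> \<in> space M"
    have "(\<Sum>b\<in>f ` space M. indicator (f -` {b} \<inter> space M) \<omega> *\<^sub>R Z \<omega>) =
        (\<Sum>b\<in>f ` space M. if b = f \<omega> then Z \<omega> else 0)"
      using \<omega> by (intro sum.cong) (auto simp: indicator_def)
    then show "Z \<omega> = (\<Sum>b\<in>f ` space M. indicator (f -` {b} \<inter> space M) \<omega> *\<^sub>R Z \<omega>)"
      using \<omega> simple_functionD(1)[OF f] by (simp add: sum.delta)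
  qed simp
  also have "\<dots> = (\<Sum>b\<in>f ` space M. LINT \<omega>:f -` {b} \<inter> space M|M. Z \<omega>)"
    unfolding set_lebesgue_integral_def
    using simple_functionD(2)[OF f] Z
    by (intro Bochner_Integration.integral_sum integrable_mult_indicator) auto
  finally show ?thesis .
qed

lemma integrable_mult_simple:
  fixes X Y :: "'a \<Rightarrow> real"
  assumes X: "integrable M X" and Y: "simple_function M Y"
  shows "integrable M (\<lambda>\<omega>. X \<omega> * Y \<omega>)"
proof -
  obtain K where K: "\<And>\<omega>. \<omega> \<in> space M \<Longrightarrow> \<bar>Y \<omega>\<bar> \<le> K"
    using finite_imp_bounded[OF simple_functionD(1)[OF Y]] by (auto simp: bounded_iff)
  have [measurable]: "Y \<in> borel_measurable M" "X \<in> borel_measurable M"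
    using Y X by (auto intro: borel_measurable_simple_function)
  show ?thesis
  proof (rule Bochner_Integration.integrable_bound)
    show "integrable M (\<lambda>\<omega>. K * X \<omega>)" using X by simp
    show "AE \<omega> in M. norm (X \<omega> * Y \<omega>) \<le> norm (K * X \<omega>)"
      using AE_space
    proof eventually_elim
      case (elim \<omega>)
      then have "\<bar>Y \<omega>\<bar> \<le> \<bar>K\<bar>" using K[of \<omega>] by linarith
      then show ?case by (simp add: abs_mult mult.commute[of "\<bar>X \<omega>\<bar>"] mult_right_mono)
    qed
  qed measurable
qed

text \<open>On each level \<open>Y\<close> is a constant factor and averaging preserves the
  integral. In the uniqueness proof, this makes \<open>X\<close> and its level average
  indistinguishable by finitely many test functions at once.\<close>

lemma level_avg_integral_mult:
  assumes f: "simple_function M f" and X: "integrable M X" and Y: "simple_function M Y"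
    and const: "\<And>\<omega> \<omega>'. f \<omega> = f \<omega>' \<Longrightarrow> Y \<omega> = Y \<omega>'"
  shows "(\<integral>\<omega>. level_avg M f X \<omega> * Y \<omega> \<partial>M) = (\<integral>\<omega>. X \<omega> * Y \<omega> \<partial>M)"
proof -
  have "integrable M (\<lambda>\<omega>. X \<omega> * Y \<omega>)"
    using X Y by (rule integrable_mult_simple)
  moreover have "integrable M (\<lambda>\<omega>. level_avg M f X \<omega> * Y \<omega>)"
    by (intro integrable_simple simple_function_mult simple_level_avg f Y)
  moreover have "(LINT \<omega>:f -` {b} \<inter> space M|M. level_avg M f X \<omega> * Y \<omega>) =
      (LINT \<omega>:f -` {b} \<inter> space M|M. X \<omega> * Y \<omega>)" if b: "b \<in> f ` space M" for b
  proof -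
    obtain \<omega>0 where "b = f \<omega>0" using b by auto
    let ?A = "f -` {b} \<inter> space M"
    have A: "?A \<in> sets M" by (rule simple_functionD(2)[OF f])
    have c: "Y \<omega> = Y \<omega>0" if "\<omega> \<in> ?A" for \<omega> using that \<open>b = f \<omega>0\<close> by (intro const) auto
    have "(LINT \<omega>:?A|M. level_avg M f X \<omega> * Y \<omega>) = (LINT \<omega>:?A|M. set_avg M ?A X * Y \<omega>0)"
      using A c by (intro set_lebesgue_integral_cong) (auto simp: level_avg_def)
    also have "\<dots> = (LINT \<omega>:?A|M. X \<omega>) * Y \<omega>0"
      using A set_avg_mult[of ?A X] by (simp add: set_integral_const_real algebra_simps)
    also have "\<dots> = (LINT \<omega>:?A|M. X \<omega> * Y \<omega>0)" by simp
    also have "\<dots> = (LINT \<omega>:?A|M. X \<omega> * Y \<omega>)"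
      using A c by (intro set_lebesgue_integral_cong) auto
    finally show ?thesis .
  qed
  ultimately show ?thesis by (simp add: set_integral_levels[OF f])
qed

end

section \<open>Sets of prescribed probability\<close>

context prob_space
begin

text \<open>A subset of strictly smaller positive probability or its complement in the set has at
  most half of the probability; iteration gives the bounds \<open>(1 / 2) ^ n\<close>.\<close>

lemma nonatomic_small_subset:
  assumes na: "nonatomic M" and A: "A \<in> sets M" "prob A > 0" and e: "e > 0"
  obtains B where "B \<in> sets M" "B \<subseteq> A" "0 < prob B" "prob B \<le> e"
proof -
  have half: "\<exists>B\<in>sets M. B \<subseteq> C \<and> 0 < prob B \<and> prob B \<le> prob C / 2"
    if C: "C \<in> sets M" "prob C > 0" for C
  proof -
    obtain B where B: "B \<in> sets M" "B \<subseteq> C" "0 < prob B" "prob B < prob C"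
      using na C unfolding nonatomic_def by blast
    have *: "prob (C - B) = prob C - prob B" using B C by (simp add: finite_measure_Diff)
    show ?thesis
    proof (cases "prob B \<le> prob C / 2")
      case True
      then show ?thesis using B by blast
    next
      case False
      then show ?thesis using B C * by (intro bexI[of _ "C - B"]) auto
    qed
  qed
  obtain n where n: "(1 / 2 :: real) ^ n < e"
    using real_arch_pow_inv[OF e, of "1 / 2"] by auto
  have "\<exists>B\<in>sets M. B \<subseteq> A \<and> 0 < prob B \<and> prob B \<le> (1 / 2) ^ n"
  proof (induction n)
    case 0
    then show ?case using A by auto
  next
    case (Suc n)
    then obtain C where C: "C \<in> sets M" "C \<subseteq> A" "0 < prob C" "prob C \<le> (1 / 2) ^ n" by blast
    obtain B where "B \<in> sets M" "B \<subseteq> C" "0 < prob B" "prob B \<le> prob C / 2"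
      using half[OF C(1,3)] by blast
    then show ?case using C by (intro bexI[of _ B]) auto
  qed
  then obtain B where "B \<in> sets M" "B \<subseteq> A" "0 < prob B" "prob B \<le> (1 / 2) ^ n" by blast
  then show ?thesis using n by (intro that[of B]) auto
qed

text \<open>
  Greedy exhaustion: in each step add a set that has at least half of the largest probability
  that still fits below \<open>s\<close>.
\<close>

lemma nonatomic_subset:
  assumes na: "nonatomic M" and A: "A \<in> sets M" and s: "0 \<le> s" "s \<le> prob A"
  obtains B where "B \<in> sets M" "B \<subseteq> A" "prob B = s"
proof -
  define cand where "cand B = {C \<in> sets M. C \<subseteq> A - B \<and> prob B + prob C \<le> s}" for B
  define m where "m B = (SUP C\<in>cand B. prob C)" for B
  have bdd: "bdd_above (prob ` cand B)" for B by (auto intro!: bdd_aboveI[of _ 1])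
  define step where "step B = B \<union> (SOME C. C \<in> cand B \<and> prob C \<ge> m B / 2)" for B
  define B where "B n = (step ^^ n) {}" for n
  have ex: "\<exists>C. C \<in> cand D \<and> prob C \<ge> m D / 2" if "prob D \<le> s" for D
  proof -
    have ne: "{} \<in> cand D" using that by (simp add: cand_def)
    show ?thesis
    proof (cases "m D > 0")
      case True
      then have "m D / 2 < m D" by simp
      then obtain C where "C \<in> cand D" "m D / 2 < prob C"
        unfolding m_def using less_cSUP_iff[OF _ bdd[of D]] ne by (metis empty_iff)
      then show ?thesis by (auto intro: less_imp_le)
    next
      case False
      then show ?thesis using ne by (intro exI[of _ "{}"]) auto
    qed
  qed
  have inv: "B n \<in> sets M \<and> B n \<subseteq> A \<and> prob (B n) \<le> s" for n
  proof (induction n)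
    case (Suc n)
    define C where "C = (SOME C. C \<in> cand (B n) \<and> prob C \<ge> m (B n) / 2)"
    have C: "C \<in> cand (B n)" "prob C \<ge> m (B n) / 2"
      using someI_ex[OF ex[of "B n"]] Suc unfolding C_def by auto
    have "B (Suc n) = B n \<union> C" by (simp add: B_def step_def C_def)
    moreover have "prob (B n \<union> C) = prob (B n) + prob C"
      using C Suc by (intro finite_measure_Union) (auto simp: cand_def)
    ultimately show ?case using C Suc by (auto simp: cand_def)
  qed (use s in \<open>simp add: B_def\<close>)
  have stepB: "B n \<subseteq> B (Suc n)" "prob (B (Suc n)) \<ge> prob (B n) + m (B n) / 2" for n
  proof -
    define C where "C = (SOME C. C \<in> cand (B n) \<and> prob C \<ge> m (B n) / 2)"
    have C: "C \<in> cand (B n)" "prob C \<ge> m (B n) / 2"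
      using someI_ex[OF ex[of "B n"]] inv unfolding C_def by auto
    have *: "B (Suc n) = B n \<union> C" by (simp add: B_def step_def C_def)
    then show "B n \<subseteq> B (Suc n)" by auto
    have "prob (B n \<union> C) = prob (B n) + prob C"
      using C inv[of n] by (intro finite_measure_Union) (auto simp: cand_def)
    then show "prob (B (Suc n)) \<ge> prob (B n) + m (B n) / 2" using C * by simp
  qed
  let ?U = "\<Union>n. B n"
  have U: "?U \<in> sets M" "?U \<subseteq> A" using inv by auto
  have inc: "incseq B" using stepB(1) by (rule incseq_SucI)
  have lim: "(\<lambda>n. prob (B n)) \<longlonglongrightarrow> prob ?U"
    using inv inc by (intro finite_Lim_measure_incseq) auto
  then have le: "prob ?U \<le> s" by (rule LIMSEQ_le_const2) (use inv in auto)
  have "prob ?U = s"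
  proof (rule ccontr)
    assume "prob ?U \<noteq> s"
    then have lt: "prob ?U < s" using le by simp
    then have "prob (A - ?U) > 0" using U A s by (simp add: finite_measure_Diff)
    then obtain C where C: "C \<in> sets M" "C \<subseteq> A - ?U" "0 < prob C" "prob C \<le> s - prob ?U"
      using nonatomic_small_subset[OF na, of "A - ?U" "s - prob ?U"] U A lt
      by (metis diff_gt_0_iff_gt sets.Diff)
    \<comment> \<open>A set that fits beside the whole union fits beside every \<open>B n\<close>.
      Each step would then gain at least \<open>prob C / 2\<close>, although the gains tend to
      0.\<close>
    have "C \<in> cand (B n)" for n
    proof -
      have "prob (B n) \<le> prob ?U" using U by (intro finite_measure_mono) auto
      then show ?thesis using C by (auto simp: cand_def)
    qed
    then have mC: "prob C \<le> m (B n)" for n unfolding m_def by (intro cSUP_upper bdd)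
    have "(\<lambda>n. prob (B (Suc n)) - prob (B n)) \<longlonglongrightarrow> prob ?U - prob ?U"
      by (intro tendsto_diff LIMSEQ_Suc lim)
    moreover have "prob C / 2 \<le> prob (B (Suc n)) - prob (B n)" for n
      using mC[of n] stepB(2)[of n] by simp
    ultimately have "prob C / 2 \<le> prob ?U - prob ?U" by (intro LIMSEQ_le_const) auto
    then show False using C by simp
  qed
  with U that show ?thesis by blast
qed

end

section \<open>Functionals with the Fatou property\<close>

lemma AE_all_nat: "(\<And>n::nat. AE \<omega> in M. P n \<omega>) \<Longrightarrow> AE \<omega> in M. \<forall>n. P n \<omega>"
  by (simp add: AE_all_countable)

lemma tail_integral_tendsto_0:
  fixes X :: "'a \<Rightarrow> real"
  assumes iX: "integrable M X"
  shows "(\<lambda>k. LINT \<omega>:{\<omega>\<in>space M. \<bar>X \<omega>\<bar> > real k}|M. \<bar>X \<omega>\<bar>) \<longlonglongrightarrow> 0"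
proof -
  have [measurable]: "X \<in> borel_measurable M" using iX by auto
  have iA: "integrable M (\<lambda>x. \<bar>X x\<bar>)" using iX by simp
  have "(\<lambda>k. \<integral>\<omega>. indicator {\<omega>\<in>space M. \<bar>X \<omega>\<bar> > real k} \<omega> *\<^sub>R \<bar>X \<omega>\<bar> \<partial>M) \<longlonglongrightarrow> (\<integral>\<omega>. 0 \<partial>M)"
  proof (rule integral_dominated_convergence[OF _ _ iA])
    show "AE \<omega> in M. (\<lambda>k. indicator {\<omega>\<in>space M. \<bar>X \<omega>\<bar> > real k} \<omega> *\<^sub>R \<bar>X \<omega>\<bar>) \<longlonglongrightarrow> 0"
    proof (rule AE_I2)
      fix \<omega>
      obtain l where "\<bar>X \<omega>\<bar> \<le> real l" using real_arch_simple by blast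
      then have "indicator {\<omega>\<in>space M. \<bar>X \<omega>\<bar> > real k} \<omega> *\<^sub>R \<bar>X \<omega>\<bar> = 0" if "k \<ge> l" for k
        using that by (simp add: indicator_def)
      then show "(\<lambda>k. indicator {\<omega>\<in>space M. \<bar>X \<omega>\<bar> > real k} \<omega> *\<^sub>R \<bar>X \<omega>\<bar>) \<longlonglongrightarrow> 0"
        by (intro tendsto_eventually eventually_sequentiallyI)
    qed
    show "AE \<omega> in M. norm (indicator {\<omega>\<in>space M. \<bar>X \<omega>\<bar> > real k} \<omega> *\<^sub>R \<bar>X \<omega>\<bar>) \<le> \<bar>X \<omega>\<bar>" for k
      by (intro AE_I2) (simp add: indicator_def)
    show "(\<lambda>\<omega>. indicator {\<omega>\<in>space M. \<bar>X \<omega>\<bar> > real k} \<omega> *\<^sub>R \<bar>X \<omega>\<bar>) \<in> borel_measurable M" for k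
      by measurable
  qed simp
  then show ?thesis by (simp add: set_lebesgue_integral_def)
qed

lemma ideal_generated_dominated:
  assumes S: "S \<subseteq> L1 M" "(\<lambda>_. 1) \<in> S" and X: "X \<in> S" and Z: "Z \<in> L1 M"
    and le: "AE \<omega> in M. \<bar>Z \<omega>\<bar> \<le> \<bar>X \<omega>\<bar> + c"
  shows "Z \<in> ideal_generated M S"
  unfolding ideal_generated_def hull_def
proof safe
  fix J assume J: "L1_ideal M J" "S \<subseteq> J"
  then have add: "\<And>U V. U \<in> J \<Longrightarrow> V \<in> J \<Longrightarrow> (\<lambda>\<omega>. U \<omega> + V \<omega>) \<in> J"
    and mult: "\<And>U a. U \<in> J \<Longrightarrow> (\<lambda>\<omega>. a * U \<omega>) \<in> J"
    and solid: "\<And>U V. U \<in> L1 M \<Longrightarrow> V \<in> J \<Longrightarrow> (AE \<omega> in M. \<bar>U \<omega>\<bar> \<le> \<bar>V \<omega>\<bar>) \<Longrightarrow> U \<in> J"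
    unfolding L1_ideal_def by blast+
  have "(\<lambda>\<omega>. \<bar>X \<omega>\<bar>) \<in> L1 M" using S X by (auto simp: L1_def)
  then have 1: "(\<lambda>\<omega>. \<bar>X \<omega>\<bar>) \<in> J" by (rule solid[of _ X]) (use J X in auto)
  have 2: "(\<lambda>\<omega>. c * 1) \<in> J" by (rule mult[of "\<lambda>_. 1"]) (use J S in auto)
  show "Z \<in> J"
  proof (rule solid[OF Z add[OF 1 2]])
    show "AE \<omega> in M. \<bar>Z \<omega>\<bar> \<le> \<bar>\<bar>X \<omega>\<bar> + c * 1\<bar>"
      using le by eventually_elim auto
  qed
qed

text \<open>\<open>None\<close> is the label of the remainder cell. With \<open>B = {}\<close> this
  cell is the bare tail, which is the case used for law invariance.\<close>

lemma simple_discretise: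
  assumes X: "X \<in> borel_measurable M" and B: "B \<in> sets M"
  shows "simple_function M
    (\<lambda>\<omega>. if \<omega> \<in> B \<or> \<bar>X \<omega>\<bar> > real N then None else Some \<lfloor>X \<omega> * real n\<rfloor>)" (is "simple_function M ?f")
  unfolding simple_function_eq_measurable
proof
  have "?f ` space M \<subseteq> insert None (Some ` {- int (N * n)..int (N * n)})"
  proof (rule image_subsetI)
    fix \<omega>
    show "?f \<omega> \<in> insert None (Some ` {- int (N * n)..int (N * n)})"
    proof (cases "?f \<omega> = None")
      case False
      then have le: "\<bar>X \<omega>\<bar> \<le> real N" by (auto split: if_splits)
      then have "\<bar>X \<omega> * real n\<bar> \<le> real (N * n)" by (simp add: abs_mult mult_right_mono)
      then have "\<lfloor>X \<omega> * real n\<rfloor> \<in> {- int (N * n)..int (N * n)}"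
        by (auto simp: abs_le_iff le_floor_iff floor_le_iff)
      then show ?thesis by auto
    qed simp
  qed
  then show "finite (?f ` space M)" by (rule finite_subset) simp
  show "?f \<in> measurable M (count_space UNIV)" using X B by measurable
qed

lemma floor_scale_close:
  assumes "\<lfloor>x * real (Suc n)\<rfloor> = \<lfloor>y * real (Suc n)\<rfloor>"
  shows "\<bar>x - y\<bar> \<le> 1 / real (Suc n)"
proof -
  have "\<bar>x * real (Suc n) - y * real (Suc n)\<bar> \<le> 1" using assms by linarith
  then have "\<bar>x - y\<bar> * real (Suc n) \<le> 1"
    by (simp add: left_diff_distrib[symmetric] abs_mult del: of_nat_Suc)
  then show ?thesis by (simp add: pos_le_divide_eq del: of_nat_Suc)
qed

locale dilatation_monotone_Fatou = prob_space M for M :: "'a measure" +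
  fixes S :: "('a \<Rightarrow> real) set" and \<rho> :: "('a \<Rightarrow> real) \<Rightarrow> ereal"
  assumes na: "nonatomic M"
    and S: "L1_subset M S" and simple_S: "simple_rvs M \<subseteq> S"
    and rho_fun: "functional_on M S \<rho>"
    and dm: "dilatation_monotone M S \<rho>" and Fatou: "Fatou_property M S \<rho>"
begin

lemma S_integrable: "X \<in> S \<Longrightarrow> integrable M X"
  using S by (auto simp: L1_subset_def L1_def)

lemma simple_in_S: "simple_function M X \<Longrightarrow> X \<in> S"
  using simple_S by (auto simp: simple_rvs_def)

lemma rho_cong_AE: "X \<in> S \<Longrightarrow> Y \<in> S \<Longrightarrow> AE \<omega> in M. X \<omega> = Y \<omega> \<Longrightarrow> \<rho> X = \<rho> Y"
  using rho_fun unfolding functional_on_def by blast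

text \<open>Membership of the supremum in the ideal is replaced by a pointwise bound. This bound
  makes the supremum a.s. finite, so the default value of \<open>real_of_ereal\<close> matters only
  on a null set.\<close>

lemma Fatou_dominated:
  assumes Xs: "\<And>n. Xs n \<in> S" and X: "X \<in> S" and lim: "AE \<omega> in M. (\<lambda>n. Xs n \<omega>) \<longlonglongrightarrow> X \<omega>"
    and W: "W \<in> S" "AE \<omega> in M. \<forall>n. \<bar>Xs n \<omega>\<bar> \<le> \<bar>W \<omega>\<bar> + c"
  shows "\<rho> X \<le> liminf (\<lambda>n. \<rho> (Xs n))"
proof -
  define Z where "Z \<omega> = real_of_ereal (SUP n. ereal \<bar>Xs n \<omega>\<bar>)" for \<omega>
  have [measurable]: "\<And>n. Xs n \<in> borel_measurable M" "W \<in> borel_measurable M"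
    using Xs W(1) S_integrable by (auto intro: borel_measurable_integrable)
  have Zm: "Z \<in> borel_measurable M" unfolding Z_def by measurable
  have Z: "AE \<omega> in M. (SUP n. ereal \<bar>Xs n \<omega>\<bar>) = ereal (Z \<omega>) \<and> \<bar>Z \<omega>\<bar> \<le> \<bar>W \<omega>\<bar> + c"
    using W(2)
  proof eventually_elim
    case (elim \<omega>)
    let ?s = "SUP n. ereal \<bar>Xs n \<omega>\<bar>"
    have le: "?s \<le> ereal (\<bar>W \<omega>\<bar> + c)" using elim by (intro SUP_least) simp
    have "ereal \<bar>Xs 0 \<omega>\<bar> \<le> ?s" by (rule SUP_upper) simp
    then have ge: "0 \<le> ?s" by (rule order_trans[rotated]) simp
    obtain r where "?s = ereal r" using le ge by (cases ?s) auto
    then show ?case using le ge by (auto simp: Z_def)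
  qed
  have "integrable M Z"
  proof (rule Bochner_Integration.integrable_bound)
    show "integrable M (\<lambda>\<omega>. \<bar>W \<omega>\<bar> + c)" using S_integrable[OF W(1)] by simp
    show "AE \<omega> in M. norm (Z \<omega>) \<le> norm (\<bar>W \<omega>\<bar> + c)" using Z by eventually_elim auto
  qed (rule Zm)
  then have "Z \<in> ideal_generated M S"
    using Z S W simple_in_S[of "\<lambda>_. 1"]
    by (intro ideal_generated_dominated[of S M W Z c]) (auto simp: L1_subset_def L1_def)
  moreover have "AE \<omega> in M. (SUP n. ereal \<bar>Xs n \<omega>\<bar>) = ereal (Z \<omega>)"
    using Z by eventually_elim blast
  ultimately show ?thesis
    using Xs X lim by (intro Fatou[unfolded Fatou_property_def, rule_format]) auto
qed

lemma Fatou_simple: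
  assumes Xs: "\<And>n. simple_function M (Xs n)" and X: "simple_function M X"
    and lim: "\<And>\<omega>. \<omega> \<in> space M \<Longrightarrow> (\<lambda>n. Xs n \<omega>) \<longlonglongrightarrow> X \<omega>"
    and bound: "\<And>n \<omega>. \<omega> \<in> space M \<Longrightarrow> \<bar>Xs n \<omega>\<bar> \<le> c"
  shows "\<rho> X \<le> liminf (\<lambda>n. \<rho> (Xs n))"
proof (rule Fatou_dominated[where W="\<lambda>_. 0" and c=c])
  show "AE \<omega> in M. \<forall>n. \<bar>Xs n \<omega>\<bar> \<le> \<bar>0\<bar> + c" using bound by auto
  show "AE \<omega> in M. (\<lambda>n. Xs n \<omega>) \<longlonglongrightarrow> X \<omega>" using lim by (rule AE_I2)
qed (intro simple_in_S Xs X simple_function_const)+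

lemma rho_level_avg:
  assumes "simple_function M f" "X \<in> S"
  shows "\<rho> (level_avg M f X) \<le> \<rho> X"
proof -
  obtain \<pi> where \<pi>: "\<pi> \<in> finite_partitions M"
    and *: "\<forall>X. integrable M X \<longrightarrow> (AE \<omega> in M. cexp_partition M \<pi> X \<omega> = level_avg M f X \<omega>)"
    by (rule cexp_level_avg[OF assms(1)])
  have "\<rho> (level_avg M f X) = \<rho> (cexp_partition M \<pi> X)"
    using S_integrable[OF assms(2)] *[rule_format, of X] assms(1)
    by (intro rho_cong_AE simple_in_S simple_level_avg simple_cexp \<pi>) auto
  also have "\<dots> \<le> \<rho> X" using dm assms(2) \<pi> by (auto simp: dilatation_monotone_def)
  finally show ?thesis .
qed

lemma rho_bar_level_avg:
  assumes "simple_function M f" "integrable M X"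
  shows "\<rho> (level_avg M f X) \<le> rho_bar M \<rho> X"
proof -
  obtain \<pi> where \<pi>: "\<pi> \<in> finite_partitions M"
    and *: "\<forall>X. integrable M X \<longrightarrow> (AE \<omega> in M. cexp_partition M \<pi> X \<omega> = level_avg M f X \<omega>)"
    by (rule cexp_level_avg[OF assms(1)])
  have "\<rho> (level_avg M f X) = \<rho> (cexp_partition M \<pi> X)"
    using *[rule_format, of X] assms
    by (intro rho_cong_AE simple_in_S simple_level_avg simple_cexp \<pi>) auto
  also have "\<dots> \<le> rho_bar M \<rho> X" unfolding rho_bar_def by (rule SUP_upper[OF \<pi>])
  finally show ?thesis .
qed

lemma rho_le_rho_bar:
  assumes X: "X \<in> S"
  shows "\<rho> X \<le> rho_bar M \<rho> X"
proof -
  have iX: "integrable M X" using X by (rule S_integrable)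
  have [measurable]: "X \<in> borel_measurable M" using iX by auto
  have iA: "integrable M (\<lambda>x. \<bar>X x\<bar>)" using iX by simp
  note tail = tail_integral_tendsto_0[OF iX]
  obtain N0 where N0: "prob {\<omega>\<in>space M. \<bar>X \<omega>\<bar> \<le> real N0} > 0"
  proof (atomize_elim, rule ccontr)
    assume "\<nexists>N0. prob {\<omega>\<in>space M. \<bar>X \<omega>\<bar> \<le> real N0} > 0"
    then have "{\<omega>\<in>space M. \<bar>X \<omega>\<bar> \<le> real N} \<in> null_sets M" for N
      by (auto simp: null_sets_def emeasure_eq_measure zero_less_measure_iff)
    then have "AE \<omega> in M. \<forall>N::nat. \<omega> \<notin> {\<omega>\<in>space M. \<bar>X \<omega>\<bar> \<le> real N}"
      by (intro AE_all_nat AE_not_in)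
    with AE_space have "AE \<omega> in M. False"
      by eventually_elim (use real_arch_simple in auto)
    then show False by simp
  qed
  let ?D = "{\<omega>\<in>space M. \<bar>X \<omega>\<bar> \<le> real N0}"
  \<comment> \<open>The sets are nested, so a point that has left one of them never returns to a
    later one; the bounds \<open>1 / real (Suc n)\<close> make the intersection null, so almost
    every point leaves.\<close>
  define B where "B = rec_nat ?D (\<lambda>n C. SOME B. B \<in> sets M \<and> B \<subseteq> C \<and> 0 < prob B \<and> prob B \<le> 1 / real (Suc n))"
  have small: "\<exists>B. B \<in> sets M \<and> B \<subseteq> C \<and> 0 < prob B \<and> prob B \<le> 1 / real (Suc n)"
    if C: "C \<in> sets M" "prob C > 0" for C n
  proof -
    have "0 < 1 / real (Suc n)" by simp
    then obtain D where "D \<in> sets M" "D \<subseteq> C" "0 < prob D" "prob D \<le> 1 / real (Suc n)"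
      by (rule nonatomic_small_subset[OF na C])
    then show ?thesis by blast
  qed
  have B_Suc: "B (Suc n) = (SOME D. D \<in> sets M \<and> D \<subseteq> B n \<and> 0 < prob D \<and> prob D \<le> 1 / real (Suc n))" for n
    by (simp add: B_def)
  have B0: "B n \<in> sets M \<and> 0 < prob (B n)" for n
  proof (induction n)
    case 0
    then show ?case using N0 by (simp add: B_def)
  next
    case (Suc n)
    then show ?case unfolding B_Suc using someI_ex[OF small[of "B n" n]] by blast
  qed
  then have B1: "B (Suc n) \<subseteq> B n \<and> prob (B (Suc n)) \<le> 1 / real (Suc n)" for n
    using someI_ex[OF small[of "B n" n]] unfolding B_Suc by blast
  have Bdec: "decseq B" using B1 by (auto intro: decseq_SucI)
  then have BD: "B n \<subseteq> ?D" for n using decseqD[of B 0 n] by (simp add: B_def)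
  have null: "AE \<omega> in M. \<exists>n. \<omega> \<notin> B n"
  proof -
    have "prob (\<Inter>n. B n) \<le> 0"
    proof (rule LIMSEQ_le_const)
      show "(\<lambda>n. 1 / real (Suc n)) \<longlonglongrightarrow> 0" by (rule LIMSEQ_Suc[OF lim_const_over_n])
      have "prob (\<Inter>n. B n) \<le> 1 / real (Suc n)" for n
        using finite_measure_mono[of "\<Inter>n. B n" "B (Suc n)"] B0 B1[of n] by fastforce
      then show "\<exists>K. \<forall>n\<ge>K. prob (\<Inter>n. B n) \<le> 1 / real (Suc n)" by blast
    qed
    then have "(\<Inter>n. B n) \<in> null_sets M"
      using B0 by (auto simp: null_sets_def emeasure_eq_measure measure_le_0_iff)
    then have "AE \<omega> in M. \<omega> \<notin> (\<Inter>n. B n)" by (rule AE_not_in)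
    then show ?thesis by eventually_elim auto
  qed
  \<comment> \<open>The threshold serves three purposes: \<open>N0 \<le> N\<close> keeps the tail
    disjoint from \<open>B n\<close>, \<open>n \<le> N\<close> makes every point leave the tails
    eventually, and the integral bound caps the average over the remainder cell.\<close>
  have "\<exists>N. n + N0 \<le> N \<and> (LINT \<omega>:{\<omega>\<in>space M. \<bar>X \<omega>\<bar> > real N}|M. \<bar>X \<omega>\<bar>) \<le> prob (B n)" for n
  proof -
    have "\<forall>\<^sub>F N in sequentially. (LINT \<omega>:{\<omega>\<in>space M. \<bar>X \<omega>\<bar> > real N}|M. \<bar>X \<omega>\<bar>) < prob (B n)"
      using order_tendstoD(2)[OF tail, of "prob (B n)"] B0 by blast
    then have "\<forall>\<^sub>F N in sequentially. n + N0 \<le> N \<and>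
        (LINT \<omega>:{\<omega>\<in>space M. \<bar>X \<omega>\<bar> > real N}|M. \<bar>X \<omega>\<bar>) \<le> prob (B n)"
      using eventually_ge_at_top[of "n + N0"] by eventually_elim simp
    then show ?thesis unfolding eventually_sequentially by blast
  qed
  then obtain N where "\<forall>n. n + N0 \<le> N n \<and>
      (LINT \<omega>:{\<omega>\<in>space M. \<bar>X \<omega>\<bar> > real (N n)}|M. \<bar>X \<omega>\<bar>) \<le> prob (B n)"
    using choice[of "\<lambda>n N. n + N0 \<le> N \<and>
      (LINT \<omega>:{\<omega>\<in>space M. \<bar>X \<omega>\<bar> > real N}|M. \<bar>X \<omega>\<bar>) \<le> prob (B n)"] by blast
  then have N: "\<And>n. n + N0 \<le> N n"
      "\<And>n. (LINT \<omega>:{\<omega>\<in>space M. \<bar>X \<omega>\<bar> > real (N n)}|M. \<bar>X \<omega>\<bar>) \<le> prob (B n)" by auto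
  define f where "f n \<omega> = (if \<omega> \<in> B n \<or> \<bar>X \<omega>\<bar> > real (N n) then None else Some \<lfloor>X \<omega> * real (Suc n)\<rfloor>)" for n \<omega>
  have f: "simple_function M (f n)" for n
    unfolding f_def using B0 by (intro simple_discretise) auto
  define Xs where "Xs n = level_avg M (f n) X" for n
  have close: "AE \<omega> in M. \<forall>n. f n \<omega> \<noteq> None \<longrightarrow> \<bar>Xs n \<omega> - X \<omega>\<bar> \<le> 1 / real (Suc n)"
  proof (rule AE_all_nat)
    fix n
    show "AE \<omega> in M. f n \<omega> \<noteq> None \<longrightarrow> \<bar>Xs n \<omega> - X \<omega>\<bar> \<le> 1 / real (Suc n)"
      using AE_level_avg_close[OF f iX, of n]
    proof eventually_elim
      case (elim \<omega>)
      have "\<forall>\<omega>'\<in>space M. f n \<omega>' = f n \<omega> \<longrightarrow> \<bar>X \<omega>' - X \<omega>\<bar> \<le> 1 / real (Suc n)" if "f n \<omega> \<noteq> None"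
        using that by (auto simp: f_def simp del: of_nat_Suc split: if_splits intro!: floor_scale_close)
      then show ?case using elim by (auto simp: Xs_def)
    qed
  qed
  \<comment> \<open>On the remainder cell the integral of \<open>\<bar>X\<bar>\<close> is at most
    \<open>N0 * prob (B n)\<close> from \<open>B n\<close> plus \<open>prob (B n)\<close> from the
    tail. Since the cell contains \<open>B n\<close>, dividing by its probability leaves at most
    \<open>1 + N0\<close>.\<close>
  have bad: "\<bar>Xs n \<omega>\<bar> \<le> 1 + real N0" if "f n \<omega> = None" "\<omega> \<in> space M" for n \<omega>
  proof -
    let ?T = "{\<omega>\<in>space M. \<bar>X \<omega>\<bar> > real (N n)}"
    have eq: "f n -` {f n \<omega>} \<inter> space M = B n \<union> ?T"
      using that BD[of n] by (auto simp: f_def split: if_splits)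
    have T: "?T \<in> sets M" by measurable
    have "(LINT \<omega>:B n \<union> ?T|M. \<bar>X \<omega>\<bar>) = (LINT \<omega>:B n|M. \<bar>X \<omega>\<bar>) + (LINT \<omega>:?T|M. \<bar>X \<omega>\<bar>)"
    proof (rule set_integral_Un)
      show "B n \<inter> ?T = {}" using BD[of n] N(1)[of n] by fastforce
      show "set_integrable M (B n) (\<lambda>\<omega>. \<bar>X \<omega>\<bar>)" "set_integrable M ?T (\<lambda>\<omega>. \<bar>X \<omega>\<bar>)"
        using B0 T iA by blast+
    qed
    also have "(LINT \<omega>:B n|M. \<bar>X \<omega>\<bar>) \<le> (LINT \<omega>:B n|M. real N0)"
      using B0 BD by (intro set_integral_mono set_integrable_L1) (auto simp: iA)
    also have "(LINT \<omega>:B n|M. real N0) + (LINT \<omega>:?T|M. \<bar>X \<omega>\<bar>) \<le> (1 + real N0) * prob (B n)"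
      using N(2)[of n] B0[of n] by (simp add: set_integral_const_real algebra_simps)
    also have "\<dots> \<le> (1 + real N0) * prob (B n \<union> ?T)"
      using B0 T by (intro mult_left_mono finite_measure_mono) auto
    finally have "(LINT \<omega>:B n \<union> ?T|M. \<bar>X \<omega>\<bar>) \<le> (1 + real N0) * prob (B n \<union> ?T)" by simp
    moreover have "prob (B n) \<le> prob (B n \<union> ?T)" using B0 T by (intro finite_measure_mono) auto
    then have "prob (B n \<union> ?T) > 0" using B0[of n] by linarith
    ultimately have "set_avg M (B n \<union> ?T) (\<lambda>x. \<bar>X x\<bar>) \<le> 1 + real N0"
      by (simp add: set_avg_def pos_divide_le_eq)
    moreover have "B n \<union> ?T \<in> sets M" using B0 T by blast
    note abs_set_avg_le[OF this iX]
    ultimately show ?thesis unfolding Xs_def level_avg_def eq by linarith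
  qed
  have "\<rho> X \<le> liminf (\<lambda>n. \<rho> (Xs n))"
  proof (rule Fatou_dominated[where W=X and c="1 + real N0"])
    show "Xs n \<in> S" for n unfolding Xs_def by (rule simple_in_S[OF simple_level_avg[OF f]])
    show "X \<in> S" "X \<in> S" by (rule X)+
    show "AE \<omega> in M. (\<lambda>n. Xs n \<omega>) \<longlonglongrightarrow> X \<omega>"
      using close null AE_space
    proof eventually_elim
      case (elim \<omega>)
      then obtain k where k: "\<omega> \<notin> B k" by blast
      obtain l where l: "\<bar>X \<omega>\<bar> \<le> real l" using real_arch_simple by blast
      have ev: "\<forall>\<^sub>F n in sequentially. f n \<omega> \<noteq> None"
        using eventually_ge_at_top[of "max k l"]
      proof eventually_elim
        case (elim n)
        then have "\<omega> \<notin> B n" "real l \<le> real (N n)"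
          using k decseqD[OF Bdec, of k n] N(1)[of n] by auto
        then show ?case using l by (auto simp: f_def)
      qed
      have "(\<lambda>n. Xs n \<omega> - X \<omega>) \<longlonglongrightarrow> 0"
      proof (rule Lim_null_comparison)
        show "\<forall>\<^sub>F n in sequentially. norm (Xs n \<omega> - X \<omega>) \<le> 1 / real (Suc n)"
          using ev by eventually_elim (use elim in auto)
        show "(\<lambda>n. 1 / real (Suc n)) \<longlonglongrightarrow> 0" by (rule LIMSEQ_Suc[OF lim_const_over_n])
      qed
      then show ?case by (rule LIM_zero_cancel)
    qed
    show "AE \<omega> in M. \<forall>n. \<bar>Xs n \<omega>\<bar> \<le> \<bar>X \<omega>\<bar> + (1 + real N0)"
      using close AE_space
    proof eventually_elim
      case (elim \<omega>)
      show ?case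
      proof
        fix n
        have "1 / real (Suc n) \<le> 1" by simp
        moreover have "f n \<omega> = None \<or> \<bar>Xs n \<omega> - X \<omega>\<bar> \<le> 1 / real (Suc n)" using elim(1) by blast
        ultimately show "\<bar>Xs n \<omega>\<bar> \<le> \<bar>X \<omega>\<bar> + (1 + real N0)"
          using bad[of n \<omega>] elim(2) by (elim disjE) (simp, linarith)
      qed
    qed
  qed
  also have "\<dots> \<le> liminf (\<lambda>n::nat. rho_bar M \<rho> X)"
  proof (intro Liminf_mono always_eventually allI)
    show "\<rho> (Xs n) \<le> rho_bar M \<rho> X" for n
      unfolding Xs_def by (rule rho_bar_level_avg[OF f iX])
  qed
  also have "\<dots> = rho_bar M \<rho> X" by (simp add: Liminf_const)
  finally show ?thesis .
qed

lemma rho_bar_extends: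
  assumes "X \<in> S"
  shows "rho_bar M \<rho> X = \<rho> X"
proof (rule antisym)
  show "rho_bar M \<rho> X \<le> \<rho> X"
    unfolding rho_bar_def using dm assms by (intro SUP_least) (simp add: dilatation_monotone_def)
qed (rule rho_le_rho_bar[OF assms])

end

section \<open>The extension to integrable random variables\<close>

context prob_space
begin

lemma set_avg_linear:
  assumes "A \<in> sets M" "integrable M X" "integrable M Y"
  shows "set_avg M A (\<lambda>\<omega>. a * X \<omega> + b * Y \<omega>) = a * set_avg M A X + b * set_avg M A Y"
proof -
  have "set_integrable M A (\<lambda>\<omega>. a * X \<omega>)" "set_integrable M A (\<lambda>\<omega>. b * Y \<omega>)"
    using assms by auto
  from set_integral_add(2)[OF this] show ?thesis
    by (simp add: set_avg_def add_divide_distrib)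
qed

lemma set_avg_mono_AE:
  assumes A: "A \<in> sets M" "integrable M X" "integrable M Y" and le: "AE \<omega> in M. X \<omega> \<le> Y \<omega>"
  shows "set_avg M A X \<le> set_avg M A Y"
proof -
  have "AE \<omega>\<in>A in M. X \<omega> \<le> Y \<omega>" using le by eventually_elim simp
  then have "(LINT \<omega>:A|M. X \<omega>) \<le> (LINT \<omega>:A|M. Y \<omega>)"
    by (intro set_integral_mono_AE set_integrable_L1 A)
  then show ?thesis by (simp add: set_avg_def divide_right_mono)
qed

lemma cexp_linear:
  assumes \<pi>: "\<pi> \<in> finite_partitions M" and XY: "integrable M X" "integrable M Y" and \<omega>: "\<omega> \<in> space M"
  shows "cexp_partition M \<pi> (\<lambda>\<omega>. a * X \<omega> + b * Y \<omega>) \<omega> =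
    a * cexp_partition M \<pi> X \<omega> + b * cexp_partition M \<pi> Y \<omega>"
proof -
  obtain A where A: "A \<in> \<pi>" "\<omega> \<in> A" by (rule partition_cell[OF \<pi> \<omega>])
  have "integrable M (\<lambda>\<omega>. a * X \<omega> + b * Y \<omega>)" using XY by simp
  then show ?thesis
    using cexp_partition_eq[OF \<pi> _ A] finite_partitionsD(4)[OF \<pi> A(1)] XY by (simp add: set_avg_linear)
qed

lemma cexp_add_const:
  assumes \<pi>: "\<pi> \<in> finite_partitions M" and X: "integrable M X" and \<omega>: "\<omega> \<in> space M"
  shows "cexp_partition M \<pi> (\<lambda>\<omega>. X \<omega> + s) \<omega> = cexp_partition M \<pi> X \<omega> + s"
proof -
  obtain A where A: "A \<in> \<pi>" "\<omega> \<in> A" by (rule partition_cell[OF \<pi> \<omega>])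
  have "cexp_partition M \<pi> (\<lambda>_. s) \<omega> = s"
    using cexp_partition_eq[OF \<pi> _ A, of "\<lambda>_. s"] finite_partitionsD(4,6)[OF \<pi> A(1)]
    by (simp add: set_avg_const)
  then show ?thesis using cexp_linear[OF \<pi> X _ \<omega>, of "\<lambda>_. s" 1 1] by simp
qed

lemma cexp_mono_AE:
  assumes \<pi>: "\<pi> \<in> finite_partitions M" and XY: "integrable M X" "integrable M Y"
    and le: "AE \<omega> in M. X \<omega> \<le> Y \<omega>" and \<omega>: "\<omega> \<in> space M"
  shows "cexp_partition M \<pi> X \<omega> \<le> cexp_partition M \<pi> Y \<omega>"
proof -
  obtain A where A: "A \<in> \<pi>" "\<omega> \<in> A" by (rule partition_cell[OF \<pi> \<omega>])
  show ?thesis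
    using cexp_partition_eq[OF \<pi> _ A] set_avg_mono_AE[OF finite_partitionsD(4)[OF \<pi> A(1)] XY le] XY
    by simp
qed

lemma cexp_cong_AE:
  assumes \<pi>: "\<pi> \<in> finite_partitions M" and XY: "integrable M X" "integrable M Y"
    and eq: "AE \<omega> in M. X \<omega> = Y \<omega>" and \<omega>: "\<omega> \<in> space M"
  shows "cexp_partition M \<pi> X \<omega> = cexp_partition M \<pi> Y \<omega>"
proof (rule antisym)
  have "AE \<omega> in M. X \<omega> \<le> Y \<omega>" "AE \<omega> in M. Y \<omega> \<le> X \<omega>" using eq by (eventually_elim, simp)+
  then show "cexp_partition M \<pi> X \<omega> \<le> cexp_partition M \<pi> Y \<omega>" "cexp_partition M \<pi> Y \<omega> \<le> cexp_partition M \<pi> X \<omega>"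
    using cexp_mono_AE[OF \<pi> XY _ \<omega>] cexp_mono_AE[OF \<pi> XY(2,1) _ \<omega>] by blast+
qed

text \<open>Only equality of the integrals is recorded, not closeness, because level averages
  reproduce these integrals exactly. Finite sets of test functions arise from finite intersections
  in the generation of the topology.\<close>

lemma weak_L1_nbhd:
  assumes "openin (weak_L1_topology M) U" and "X \<in> U"
  shows "\<exists>F. finite F \<and> F \<subseteq> simple_rvs M \<and>
    (\<forall>Z\<in>L1 M. (\<forall>Y\<in>F. (\<integral>\<omega>. Z \<omega> * Y \<omega> \<partial>M) = (\<integral>\<omega>. X \<omega> * Y \<omega> \<partial>M)) \<longrightarrow> Z \<in> U)"
proof -
  have "generate_topology_on
      {{X \<in> L1 M. (\<integral>\<omega>. X \<omega> * Y \<omega> \<partial>M) \<in> U} | Y U. Y \<in> simple_rvs M \<and> open U} U"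
    using assms(1) unfolding weak_L1_topology_def by (rule openin_topology_generated_by)
  then show ?thesis using assms(2)
  proof (induction arbitrary: X)
    case Empty
    then show ?case by simp
  next
    case (Int a b)
    from Int.IH(1)[of X] Int.prems obtain F where F: "finite F" "F \<subseteq> simple_rvs M"
      "\<forall>Z\<in>L1 M. (\<forall>Y\<in>F. (\<integral>\<omega>. Z \<omega> * Y \<omega> \<partial>M) = (\<integral>\<omega>. X \<omega> * Y \<omega> \<partial>M)) \<longrightarrow> Z \<in> a" by blast
    from Int.IH(2)[of X] Int.prems obtain G where G: "finite G" "G \<subseteq> simple_rvs M"
      "\<forall>Z\<in>L1 M. (\<forall>Y\<in>G. (\<integral>\<omega>. Z \<omega> * Y \<omega> \<partial>M) = (\<integral>\<omega>. X \<omega> * Y \<omega> \<partial>M)) \<longrightarrow> Z \<in> b" by blast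
    show ?case by (rule exI[of _ "F \<union> G"]) (use F G in blast)
  next
    case (UN K)
    then obtain k where "k \<in> K" "X \<in> k" by blast
    from UN.IH[OF this] show ?case using \<open>k \<in> K\<close> by blast
  next
    case (Basis s)
    then obtain Y V where Y: "Y \<in> simple_rvs M" "s = {X \<in> L1 M. (\<integral>\<omega>. X \<omega> * Y \<omega> \<partial>M) \<in> V}" by blast
    then show ?case using Basis.prems by (intro exI[of _ "{Y}"]) simp
  qed
qed

text \<open>The list of all values of the members of \<open>F\<close> is a joint label whose levels
  refine the level sets of every member, so averaging over them keeps the integrals against all of
  \<open>F\<close>.\<close>

lemma simple_function_jointly:
  assumes "finite F" "F \<subseteq> simple_rvs M"
  shows "\<exists>f :: 'a \<Rightarrow> real list. simple_function M f \<and> (\<forall>Y\<in>F. \<forall>\<omega> \<omega>'. f \<omega> = f \<omega>' \<longrightarrow> Y \<omega> = Y \<omega>')"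
  using assms
proof (induction F)
  case empty
  then show ?case by (intro exI[of _ "\<lambda>_. []"]) simp
next
  case (insert Y F)
  then obtain f :: "'a \<Rightarrow> real list" where f: "simple_function M f" "\<forall>Y\<in>F. \<forall>\<omega> \<omega>'. f \<omega> = f \<omega>' \<longrightarrow> Y \<omega> = Y \<omega>'"
    by auto
  have "simple_function M (\<lambda>\<omega>. Y \<omega> # f \<omega>)"
    by (rule simple_function_compose2[where h="(#)"]) (use insert.prems f(1) in \<open>simp_all add: simple_rvs_def\<close>)
  then show ?case using f(2) by (intro exI[of _ "\<lambda>\<omega>. Y \<omega> # f \<omega>"]) auto
qed

end

context dilatation_monotone_Fatou
begin

text \<open>Convergent sequences are bounded and there are finitely many cells, so a constant
  dominates all these averages. No domination of the \<open>Zs\<close> themselves is involved; the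
  hypothesis fits both weak neighbourhoods and convergence in the mean.\<close>

lemma Fatou_cexp:
  assumes \<pi>: "\<pi> \<in> finite_partitions M" and Zs: "\<And>n. integrable M (Zs n)" and X: "integrable M X"
    and lim: "\<And>A. A \<in> \<pi> \<Longrightarrow> (\<lambda>n. LINT \<omega>:A|M. Zs n \<omega>) \<longlonglongrightarrow> (LINT \<omega>:A|M. X \<omega>)"
  shows "\<rho> (cexp_partition M \<pi> X) \<le> liminf (\<lambda>n. \<rho> (cexp_partition M \<pi> (Zs n)))"
proof -
  have lim': "(\<lambda>n. set_avg M A (Zs n)) \<longlonglongrightarrow> set_avg M A X" if "A \<in> \<pi>" for A
    unfolding set_avg_def using finite_partitionsD(6)[OF \<pi> that]
    by (intro tendsto_divide lim that tendsto_const) simp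
  have "\<exists>K. \<forall>n. \<bar>set_avg M A (Zs n)\<bar> \<le> K" if "A \<in> \<pi>" for A
  proof -
    have "Bseq (\<lambda>n. set_avg M A (Zs n))"
      using lim'[OF that] by (intro convergent_imp_Bseq convergentI)
    then show ?thesis by (auto simp: Bseq_def)
  qed
  then obtain K where K: "\<And>A n. A \<in> \<pi> \<Longrightarrow> \<bar>set_avg M A (Zs n)\<bar> \<le> K A" by metis
  show ?thesis
  proof (rule Fatou_simple)
    show "simple_function M (cexp_partition M \<pi> (Zs n))" for n by (rule simple_cexp[OF \<pi> Zs])
    show "simple_function M (cexp_partition M \<pi> X)" by (rule simple_cexp[OF \<pi> X])
    fix \<omega> assume "\<omega> \<in> space M"
    then obtain A where A: "A \<in> \<pi>" "\<omega> \<in> A" by (rule partition_cell[OF \<pi>])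
    show "(\<lambda>n. cexp_partition M \<pi> (Zs n) \<omega>) \<longlonglongrightarrow> cexp_partition M \<pi> X \<omega>"
      using lim'[OF A(1)] by (simp add: cexp_partition_eq[OF \<pi> _ A] Zs X)
    fix n
    have "\<bar>cexp_partition M \<pi> (Zs n) \<omega>\<bar> \<le> \<bar>K A\<bar>"
      using K[OF A(1), of n] by (simp add: cexp_partition_eq[OF \<pi> _ A] Zs)
    also have "\<dots> \<le> (\<Sum>A\<in>\<pi>. \<bar>K A\<bar>)" by (rule member_le_sum[OF A(1)]) (simp_all add: finite_partitionsD(1)[OF \<pi>])
    finally show "\<bar>cexp_partition M \<pi> (Zs n) \<omega>\<bar> \<le> (\<Sum>A\<in>\<pi>. \<bar>K A\<bar>)" .
  qed
qed

lemma rho_cexp_le_rho_bar: "\<pi> \<in> finite_partitions M \<Longrightarrow> \<rho> (cexp_partition M \<pi> X) \<le> rho_bar M \<rho> X"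
  unfolding rho_bar_def by (rule SUP_upper)

text \<open>If \<open>rho_bar\<close> exceeds \<open>l\<close> at \<open>X\<close>, a single
  partition witnesses it, and the witness sees a random variable only through its integrals over the
  cells. It remains to show that it stays a witness when these integrals change slightly.\<close>

lemma rho_bar_lsc: "lsc_functional (weak_L1_topology M) (rho_bar M \<rho>)"
  unfolding lsc_functional_def closedin_def topspace_weak_L1_topology
proof (intro allI conjI)
  fix l :: real
  have "\<exists>T. openin (weak_L1_topology M) T \<and> X \<in> T \<and> T \<subseteq> L1 M - {X \<in> L1 M. rho_bar M \<rho> X \<le> ereal l}"
    if X: "X \<in> L1 M" "\<not> rho_bar M \<rho> X \<le> ereal l" for X
  proof -
    have iX: "integrable M X" using X by (simp add: L1_def)
    obtain \<pi> where \<pi>: "\<pi> \<in> finite_partitions M" and gt: "ereal l < \<rho> (cexp_partition M \<pi> X)"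
      using X(2) unfolding rho_bar_def not_le less_SUP_iff by blast
    define near where "near n Z \<longleftrightarrow>
      (\<forall>A\<in>\<pi>. \<bar>(LINT \<omega>:A|M. Z \<omega>) - (LINT \<omega>:A|M. X \<omega>)\<bar> < 1 / real (Suc n))" for n Z
    \<comment> \<open>The conditions \<open>near n\<close> form a countable base for closeness of
      finitely many integrals, so a failure for every \<open>n\<close> would produce a sequence, to
      which the Fatou property applies.\<close>
    have "\<exists>n. \<forall>Z\<in>L1 M. near n Z \<longrightarrow> ereal l < \<rho> (cexp_partition M \<pi> Z)"
    proof (rule ccontr)
      assume "\<not> ?thesis"
      then have "\<forall>n. \<exists>Z. Z \<in> L1 M \<and> near n Z \<and> \<rho> (cexp_partition M \<pi> Z) \<le> ereal l"
        unfolding not_less[symmetric] by blast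
      from choice[OF this] obtain Zs where Zs: "\<And>n. Zs n \<in> L1 M" "\<And>n. near n (Zs n)"
        "\<And>n. \<rho> (cexp_partition M \<pi> (Zs n)) \<le> ereal l" by blast
      have "\<rho> (cexp_partition M \<pi> X) \<le> liminf (\<lambda>n. \<rho> (cexp_partition M \<pi> (Zs n)))"
      proof (rule Fatou_cexp[OF \<pi> _ iX])
        show "integrable M (Zs n)" for n using Zs(1)[of n] by (simp add: L1_def)
        fix A assume A: "A \<in> \<pi>"
        show "(\<lambda>n. LINT \<omega>:A|M. Zs n \<omega>) \<longlonglongrightarrow> (LINT \<omega>:A|M. X \<omega>)"
        proof (rule LIM_zero_cancel, rule Lim_null_comparison)
          show "\<forall>\<^sub>F n in sequentially. norm ((LINT \<omega>:A|M. Zs n \<omega>) - (LINT \<omega>:A|M. X \<omega>)) \<le> 1 / real (Suc n)"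
            using Zs(2) A unfolding near_def by (intro always_eventually allI) (simp add: less_imp_le del: of_nat_Suc)
          show "(\<lambda>n. 1 / real (Suc n)) \<longlonglongrightarrow> 0" by (rule LIMSEQ_Suc[OF lim_const_over_n])
        qed
      qed
      also have "\<dots> \<le> liminf (\<lambda>n::nat. ereal l)"
        by (intro Liminf_mono always_eventually allI Zs(3))
      also have "\<dots> = ereal l" by (simp add: Liminf_const)
      finally show False using gt by simp
    qed
    then obtain n where n: "\<And>Z. Z \<in> L1 M \<Longrightarrow> near n Z \<Longrightarrow> ereal l < \<rho> (cexp_partition M \<pi> Z)" by blast
    define N where "N A = {Z \<in> topspace (weak_L1_topology M). (\<integral>\<omega>. Z \<omega> * indicator A \<omega> \<partial>M) \<in>
      ball (\<integral>\<omega>. X \<omega> * indicator A \<omega> \<partial>M) (1 / real (Suc n))}" for A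
    have int: "(\<integral>\<omega>. Z \<omega> * indicator A \<omega> \<partial>M) = (LINT \<omega>:A|M. Z \<omega>)" for Z :: "'a \<Rightarrow> real" and A
      by (simp add: set_lebesgue_integral_def mult.commute)
    have ne: "\<pi> \<noteq> {}" using finite_partitionsD(2)[OF \<pi>] not_empty by auto
    show ?thesis
    proof (intro exI conjI)
      have "openin (weak_L1_topology M) (N A)" if "A \<in> \<pi>" for A
        unfolding N_def using finite_partitionsD(4)[OF \<pi> that]
        by (intro openin_continuous_map_preimage[OF continuous_map_weak_L1_topology])
          (auto simp: simple_rvs_def)
      then show "openin (weak_L1_topology M) (\<Inter>A\<in>\<pi>. N A)"
        using finite_partitionsD(1)[OF \<pi>] ne by (intro openin_Inter) auto
      show "X \<in> (\<Inter>A\<in>\<pi>. N A)"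
        using X by (auto simp: N_def topspace_weak_L1_topology simp del: of_nat_Suc)
      show "(\<Inter>A\<in>\<pi>. N A) \<subseteq> L1 M - {X \<in> L1 M. rho_bar M \<rho> X \<le> ereal l}"
      proof
        fix Z assume Z: "Z \<in> (\<Inter>A\<in>\<pi>. N A)"
        then have Z1: "Z \<in> L1 M" using ne by (auto simp: N_def topspace_weak_L1_topology)
        have "ereal l < \<rho> (cexp_partition M \<pi> Z)"
          using Z by (intro n Z1) (auto simp: N_def near_def int dist_real_def abs_minus_commute simp del: of_nat_Suc)
        then have "ereal l < rho_bar M \<rho> Z" using rho_cexp_le_rho_bar[OF \<pi>] by (rule less_le_trans)
        then show "Z \<in> L1 M - {X \<in> L1 M. rho_bar M \<rho> X \<le> ereal l}" using Z1 by simp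
      qed
    qed
  qed
  then show "openin (weak_L1_topology M) (L1 M - {X \<in> L1 M. rho_bar M \<rho> X \<le> ereal l})"
    by (subst openin_subopen) blast
qed auto

lemma rho_cexp_cong:
  assumes \<pi>: "\<pi> \<in> finite_partitions M" and X: "integrable M X" and Y: "simple_function M Y"
    and eq: "\<And>\<omega>. \<omega> \<in> space M \<Longrightarrow> cexp_partition M \<pi> X \<omega> = Y \<omega>"
  shows "\<rho> (cexp_partition M \<pi> X) = \<rho> Y"
  using eq by (intro rho_cong_AE simple_in_S simple_cexp \<pi> X Y AE_I2)

lemma rho_bar_functional: "functional_on M (L1 M) (rho_bar M \<rho>)"
  unfolding functional_on_def
proof (intro ballI impI)
  fix X Y assume "X \<in> L1 M" "Y \<in> L1 M" and eq: "AE \<omega> in M. X \<omega> = Y \<omega>"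
  then have XY: "integrable M X" "integrable M Y" by (auto simp: L1_def)
  have "\<rho> (cexp_partition M \<pi> X) = \<rho> (cexp_partition M \<pi> Y)" if \<pi>: "\<pi> \<in> finite_partitions M" for \<pi>
    using XY eq by (intro rho_cexp_cong \<pi> simple_cexp cexp_cong_AE)
  then show "rho_bar M \<rho> X = rho_bar M \<rho> Y" unfolding rho_bar_def by (intro SUP_cong) auto
qed

text \<open>Averaging successively over two unrelated partitions would not give an average over one.
  The difficulty is avoided because \<open>E[X|\<pi>]\<close> is simple, hence in \<open>S\<close>,
  where \<open>rho_bar\<close> is already known to agree with \<open>\<rho>\<close>.\<close>

lemma rho_bar_dilatation_monotone: "dilatation_monotone M (L1 M) (rho_bar M \<rho>)"
  unfolding dilatation_monotone_def
proof (intro ballI)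
  fix X \<pi> assume "X \<in> L1 M" and \<pi>: "\<pi> \<in> finite_partitions M"
  then have "rho_bar M \<rho> (cexp_partition M \<pi> X) = \<rho> (cexp_partition M \<pi> X)"
    by (intro rho_bar_extends simple_in_S simple_cexp) (auto simp: L1_def)
  then show "rho_bar M \<rho> (cexp_partition M \<pi> X) \<le> rho_bar M \<rho> X"
    using rho_cexp_le_rho_bar[OF \<pi>] by simp
qed

lemma rho_bar_extension: "dm_lsc_extension M S \<rho> (rho_bar M \<rho>)"
  unfolding dm_lsc_extension_def
  using rho_bar_functional rho_bar_extends rho_bar_dilatation_monotone rho_bar_lsc by blast

lemma dm_lsc_extension_unique:
  assumes \<rho>': "dm_lsc_extension M S \<rho> \<rho>'" and X: "X \<in> L1 M"
  shows "\<rho>' X = rho_bar M \<rho> X"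
proof (rule antisym)
  have iX: "integrable M X" using X by (simp add: L1_def)
  have ext: "\<And>Z. simple_function M Z \<Longrightarrow> \<rho>' Z = \<rho> Z"
    using \<rho>' simple_in_S unfolding dm_lsc_extension_def by simp
  have "\<rho> (cexp_partition M \<pi> X) \<le> \<rho>' X" if \<pi>: "\<pi> \<in> finite_partitions M" for \<pi>
  proof -
    have "\<rho>' (cexp_partition M \<pi> X) \<le> \<rho>' X"
      using \<rho>' X \<pi> unfolding dm_lsc_extension_def dilatation_monotone_def by blast
    then show ?thesis by (simp only: ext[OF simple_cexp[OF \<pi> iX]])
  qed
  then show "rho_bar M \<rho> X \<le> \<rho>' X" unfolding rho_bar_def by (rule SUP_least)
  show "\<rho>' X \<le> rho_bar M \<rho> X"
  proof (rule ccontr)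
    assume "\<not> \<rho>' X \<le> rho_bar M \<rho> X"
    then obtain l where l: "rho_bar M \<rho> X < ereal l" "ereal l < \<rho>' X"
      unfolding not_le by (blast dest: ereal_dense2)
    define U where "U = L1 M - {Z \<in> L1 M. \<rho>' Z \<le> ereal l}"
    have U: "openin (weak_L1_topology M) U" "X \<in> U"
      using \<rho>' X l(2) unfolding U_def dm_lsc_extension_def lsc_functional_def closedin_def topspace_weak_L1_topology
      by auto
    obtain F where F: "finite F" "F \<subseteq> simple_rvs M"
      "\<forall>Z\<in>L1 M. (\<forall>Y\<in>F. (\<integral>\<omega>. Z \<omega> * Y \<omega> \<partial>M) = (\<integral>\<omega>. X \<omega> * Y \<omega> \<partial>M)) \<longrightarrow> Z \<in> U"
      using weak_L1_nbhd[OF U] by blast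
    obtain f :: "'a \<Rightarrow> real list" where f: "simple_function M f"
      and const: "\<forall>Y\<in>F. \<forall>\<omega> \<omega>'. f \<omega> = f \<omega>' \<longrightarrow> Y \<omega> = Y \<omega>'"
      using simple_function_jointly[OF F(1,2)] by blast
    let ?Z = "level_avg M f X"
    have Z: "simple_function M ?Z" by (rule simple_level_avg[OF f])
    \<comment> \<open>\<open>?Z\<close> matches \<open>X\<close> against all test functions in
      \<open>F\<close>, so it lies in the neighbourhood where \<open>\<rho>'\<close> exceeds
      \<open>l\<close>. But \<open>?Z\<close> is simple, so \<open>\<rho>'\<close> and
      \<open>\<rho>\<close> agree there, and \<open>\<rho>\<close> of a level average of
      \<open>X\<close> is at most \<open>rho_bar\<close> of \<open>X\<close>.\<close>
    have "?Z \<in> U"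
    proof (rule F(3)[rule_format])
      show "?Z \<in> L1 M" using integrable_simple[OF Z] by (simp add: L1_def)
      fix Y assume "Y \<in> F"
      then show "(\<integral>\<omega>. ?Z \<omega> * Y \<omega> \<partial>M) = (\<integral>\<omega>. X \<omega> * Y \<omega> \<partial>M)"
        using F(2) const by (intro level_avg_integral_mult[OF f iX]) (auto simp: simple_rvs_def)
    qed
    then have "ereal l < \<rho>' ?Z" by (auto simp: U_def)
    also have "\<dots> = \<rho> ?Z" by (rule ext[OF Z])
    also have "\<dots> \<le> rho_bar M \<rho> X" by (rule rho_bar_level_avg[OF f iX])
    finally show False using l(1) by simp
  qed
qed

lemma rho_bar_not_MInfty:
  assumes "\<forall>X\<in>S. \<rho> X \<noteq> -\<infinity>" and X: "X \<in> L1 M"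
  shows "rho_bar M \<rho> X \<noteq> -\<infinity>"
proof -
  have "{space M} \<in> finite_partitions M"
    using not_empty prob_space by (auto simp: finite_partitions_def partition_on_space)
  then have "\<rho> (cexp_partition M {space M} X) \<le> rho_bar M \<rho> X"
      "cexp_partition M {space M} X \<in> S"
    using X by (auto intro!: rho_cexp_le_rho_bar simple_in_S simple_cexp simp: L1_def)
  then show ?thesis using assms(1) by fastforce
qed

section \<open>Preservation of monotonicity, convexity, quasiconvexity and cash-additivity\<close>

lemma rho_bar_monotone:
  assumes "monotone_functional M S \<rho>"
  shows "monotone_functional M (L1 M) (rho_bar M \<rho>)"
  unfolding monotone_functional_def
proof (intro ballI impI)
  fix X Y assume "X \<in> L1 M" "Y \<in> L1 M" and le: "AE \<omega> in M. X \<omega> \<ge> Y \<omega>"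
  then have XY: "integrable M X" "integrable M Y" by (auto simp: L1_def)
  have "\<rho> (cexp_partition M \<pi> X) \<le> \<rho> (cexp_partition M \<pi> Y)" if \<pi>: "\<pi> \<in> finite_partitions M" for \<pi>
  proof -
    have "AE \<omega> in M. cexp_partition M \<pi> X \<omega> \<ge> cexp_partition M \<pi> Y \<omega>"
      by (rule AE_I2) (rule cexp_mono_AE[OF \<pi> XY(2,1) le])
    then show ?thesis
      using assms simple_in_S[OF simple_cexp[OF \<pi>]] XY unfolding monotone_functional_def by blast
  qed
  then show "rho_bar M \<rho> X \<le> rho_bar M \<rho> Y" unfolding rho_bar_def by (intro SUP_mono) blast
qed

lemma rho_cexp_linear:
  assumes "\<pi> \<in> finite_partitions M" "X \<in> L1 M" "Y \<in> L1 M"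
  shows "\<rho> (cexp_partition M \<pi> (\<lambda>\<omega>. a * X \<omega> + b * Y \<omega>)) =
    \<rho> (\<lambda>\<omega>. a * cexp_partition M \<pi> X \<omega> + b * cexp_partition M \<pi> Y \<omega>)"
  using assms
  by (intro rho_cexp_cong cexp_linear simple_function_add simple_function_mult simple_cexp
      simple_function_const Bochner_Integration.integrable_add integrable_mult_right) (auto simp: L1_def)

lemma rho_bar_convex:
  assumes "convex_functional S \<rho>"
  shows "convex_functional (L1 M) (rho_bar M \<rho>)"
  unfolding convex_functional_def
proof (intro ballI allI impI)
  fix X Y and l :: real
  assume XY: "X \<in> L1 M" "Y \<in> L1 M" and "0 < l \<and> l < 1 \<and> (\<lambda>\<omega>. l * X \<omega> + (1 - l) * Y \<omega>) \<in> L1 M"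
  then have l: "0 < l" "l < 1" by auto
  show "rho_bar M \<rho> (\<lambda>\<omega>. l * X \<omega> + (1 - l) * Y \<omega>) \<le> ereal l * rho_bar M \<rho> X + ereal (1 - l) * rho_bar M \<rho> Y"
    unfolding rho_bar_def[of M \<rho> "\<lambda>\<omega>. l * X \<omega> + (1 - l) * Y \<omega>"]
  proof (rule SUP_least)
    fix \<pi> assume \<pi>: "\<pi> \<in> finite_partitions M"
    let ?X = "cexp_partition M \<pi> X" and ?Y = "cexp_partition M \<pi> Y"
    have s: "simple_function M ?X" "simple_function M ?Y"
      using XY by (auto intro: simple_cexp[OF \<pi>] simp: L1_def)
    then have "\<rho> (\<lambda>\<omega>. l * ?X \<omega> + (1 - l) * ?Y \<omega>) \<le> ereal l * \<rho> ?X + ereal (1 - l) * \<rho> ?Y"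
      using l by (intro assms[unfolded convex_functional_def, rule_format])
        (auto intro!: simple_in_S simple_function_add simple_function_mult)
    also have "\<dots> \<le> ereal l * rho_bar M \<rho> X + ereal (1 - l) * rho_bar M \<rho> Y"
      using l by (intro add_mono ereal_mult_left_mono rho_cexp_le_rho_bar \<pi>) auto
    finally show "\<rho> (cexp_partition M \<pi> (\<lambda>\<omega>. l * X \<omega> + (1 - l) * Y \<omega>)) \<le>
        ereal l * rho_bar M \<rho> X + ereal (1 - l) * rho_bar M \<rho> Y"
      by (simp only: rho_cexp_linear[OF \<pi> XY])
  qed
qed

lemma rho_bar_quasiconvex:
  assumes "quasiconvex_functional S \<rho>"
  shows "quasiconvex_functional (L1 M) (rho_bar M \<rho>)"
  unfolding quasiconvex_functional_def
proof (intro ballI allI impI)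
  fix X Y and l :: real
  assume XY: "X \<in> L1 M" "Y \<in> L1 M" and "0 < l \<and> l < 1 \<and> (\<lambda>\<omega>. l * X \<omega> + (1 - l) * Y \<omega>) \<in> L1 M"
  then have l: "0 < l" "l < 1" by auto
  show "rho_bar M \<rho> (\<lambda>\<omega>. l * X \<omega> + (1 - l) * Y \<omega>) \<le> max (rho_bar M \<rho> X) (rho_bar M \<rho> Y)"
    unfolding rho_bar_def[of M \<rho> "\<lambda>\<omega>. l * X \<omega> + (1 - l) * Y \<omega>"]
  proof (rule SUP_least)
    fix \<pi> assume \<pi>: "\<pi> \<in> finite_partitions M"
    let ?X = "cexp_partition M \<pi> X" and ?Y = "cexp_partition M \<pi> Y"
    have s: "simple_function M ?X" "simple_function M ?Y"
      using XY by (auto intro: simple_cexp[OF \<pi>] simp: L1_def)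
    then have "\<rho> (\<lambda>\<omega>. l * ?X \<omega> + (1 - l) * ?Y \<omega>) \<le> max (\<rho> ?X) (\<rho> ?Y)"
      using l by (intro assms[unfolded quasiconvex_functional_def, rule_format])
        (auto intro!: simple_in_S simple_function_add simple_function_mult)
    also have "\<dots> \<le> max (rho_bar M \<rho> X) (rho_bar M \<rho> Y)"
      by (intro max.mono rho_cexp_le_rho_bar \<pi>)
    finally show "\<rho> (cexp_partition M \<pi> (\<lambda>\<omega>. l * X \<omega> + (1 - l) * Y \<omega>)) \<le>
        max (rho_bar M \<rho> X) (rho_bar M \<rho> Y)"
      by (simp only: rho_cexp_linear[OF \<pi> XY])
  qed
qed

lemma rho_bar_cash_additive:
  assumes "cash_additive S \<rho>"
  shows "cash_additive (L1 M) (rho_bar M \<rho>)"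
  unfolding cash_additive_def
proof (intro ballI allI impI)
  \<comment> \<open>One inequality for all \<open>X\<close> and \<open>s\<close> is enough: applied
    to \<open>X + s\<close> with shift \<open>- s\<close> it gives the reverse one.\<close>
  have le: "rho_bar M \<rho> (\<lambda>\<omega>. X \<omega> + s) \<le> rho_bar M \<rho> X - ereal s" if X: "X \<in> L1 M" for X s
    unfolding rho_bar_def[of M \<rho> "\<lambda>\<omega>. X \<omega> + s"]
  proof (rule SUP_least)
    fix \<pi> assume \<pi>: "\<pi> \<in> finite_partitions M"
    have X: "integrable M X" using X by (simp add: L1_def)
    let ?X = "cexp_partition M \<pi> X"
    have s: "simple_function M ?X" by (rule simple_cexp[OF \<pi> X])
    have "\<rho> (cexp_partition M \<pi> (\<lambda>\<omega>. X \<omega> + s)) = \<rho> (\<lambda>\<omega>. ?X \<omega> + s)"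
      using X s by (intro rho_cexp_cong \<pi> cexp_add_const) (auto intro: simple_function_add)
    also have "\<dots> = \<rho> ?X - ereal s"
      using s by (intro assms[unfolded cash_additive_def, rule_format] simple_in_S simple_function_add) auto
    also have "\<dots> \<le> rho_bar M \<rho> X - ereal s"
      by (intro ereal_minus_mono rho_cexp_le_rho_bar \<pi>) simp
    finally show "\<rho> (cexp_partition M \<pi> (\<lambda>\<omega>. X \<omega> + s)) \<le> rho_bar M \<rho> X - ereal s" .
  qed
  fix X s assume "X \<in> L1 M" "(\<lambda>\<omega>. X \<omega> + s) \<in> L1 M"
  then show "rho_bar M \<rho> (\<lambda>\<omega>. X \<omega> + s) = rho_bar M \<rho> X - ereal s"
    using le[of X s] le[of "\<lambda>\<omega>. X \<omega> + s" "- s"]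
    by (cases "rho_bar M \<rho> X"; cases "rho_bar M \<rho> (\<lambda>\<omega>. X \<omega> + s)") auto
qed

end

section \<open>Exchange of values by averaging\<close>

context prob_space
begin

lemma set_avg_two:
  assumes A: "A \<in> sets M" "B \<in> sets M" "A \<inter> B = {}" "prob A = prob B" "prob A > 0"
    and Y: "simple_function M Y" "\<And>\<omega>. \<omega> \<in> A \<Longrightarrow> Y \<omega> = u" "\<And>\<omega>. \<omega> \<in> B \<Longrightarrow> Y \<omega> = v"
  shows "set_avg M (A \<union> B) Y = (u + v) / 2"
proof -
  have "(LINT \<omega>:A \<union> B|M. Y \<omega>) = (LINT \<omega>:A|M. Y \<omega>) + (LINT \<omega>:B|M. Y \<omega>)"
    using A(1-3) Y(1) by (intro set_integral_Un set_integrable_L1 integrable_simple)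
  moreover have "(LINT \<omega>:A|M. Y \<omega>) = (LINT \<omega>:A|M. u)" "(LINT \<omega>:B|M. Y \<omega>) = (LINT \<omega>:B|M. v)"
    using A Y(2,3) by (auto intro!: set_lebesgue_integral_cong)
  moreover have "prob (A \<union> B) = 2 * prob A"
    using A by (simp add: finite_measure_Union)
  ultimately show ?thesis
    using A by (simp add: set_avg_def set_integral_const_real field_simps)
qed

lemma AE_not_in_prob_0: "A \<in> sets M \<Longrightarrow> prob A = 0 \<Longrightarrow> AE \<omega> in M. \<omega> \<notin> A"
  by (rule AE_not_in) (simp add: null_sets_def emeasure_eq_measure)

end

text \<open>\<open>t = 1\<close> leaves \<open>Y\<close> unchanged, \<open>t = 1/2\<close> equalises, and \<open>t = 0\<close> interchanges the values.\<close>

definition exchange :: "'a set \<Rightarrow> 'a set \<Rightarrow> real \<Rightarrow> real \<Rightarrow> real \<Rightarrow> ('a \<Rightarrow> real) \<Rightarrow> 'a \<Rightarrow> real" where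
  "exchange A B x y t Y \<omega> =
    (if \<omega> \<in> A then y + t * (x - y) else if \<omega> \<in> B then x - t * (x - y) else Y \<omega>)"

lemma simple_update:
  fixes Y :: "'a \<Rightarrow> real"
  assumes "A \<in> sets M" "simple_function M Y"
  shows "simple_function M (\<lambda>\<omega>. if \<omega> \<in> A then c else Y \<omega>)"
  using assms sets.sets_into_space[OF assms(1)]
  by (intro simple_function_If_set simple_function_const) (auto simp: Int_absorb2)

lemma simple_exchange:
  assumes "A \<in> sets M" "B \<in> sets M" "simple_function M Y"
  shows "simple_function M (exchange A B x y t Y)"
  unfolding exchange_def[abs_def] by (intro simple_update assms)

text \<open>The untransferred part after \<open>n\<close> rounds of halving. The initial value
  \<open>1 / 2\<close> is plain averaging over both sets; the recursion is the effect of passing two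
  halves of one set along two halves of the other with rate \<open>t\<close> at each of the four
  contacts.\<close>

primrec exch_rate :: "nat \<Rightarrow> real" where
  "exch_rate 0 = 1 / 2"
| "exch_rate (Suc n) = exch_rate n - (exch_rate n)\<^sup>2 + exch_rate n ^ 3"

text \<open>For \<open>t \<le> 1 / 2\<close> the recursion decreases \<open>t\<close> to at most
  \<open>t * (1 - t / 2)\<close>, whose continuous analogue has solutions decaying like
  \<open>2 / n\<close>. The majorant \<open>2 / (n + 2)\<close> is reproduced because
  \<open>(n + 1) * (n + 3) \<le> (n + 2)^2\<close>.\<close>

lemma exch_rate_bounds: "0 \<le> exch_rate n \<and> exch_rate n \<le> 1 / 2 \<and> exch_rate n \<le> 2 / (real n + 2)"
proof (induction n)
  case (Suc n)
  define t s where "t = exch_rate n" and "s = 2 / (real n + 2)"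
  have t: "0 \<le> t" "t \<le> 1 / 2" "t \<le> s" and s: "s \<le> 1" using Suc by (auto simp: t_def s_def)
  have eq: "exch_rate (Suc n) = t * (1 - t * (1 - t))"
    by (simp add: t_def algebra_simps power2_eq_square power3_eq_cube)
  have p: "0 \<le> t * (1 - t)" "t * (1 - t) \<le> 1" using t by (auto intro: mult_le_one)
  have le_t: "t * (1 - t * (1 - t)) \<le> t * 1" using t p by (intro mult_left_mono) auto
  have "t / 2 \<le> t * (1 - t)" using t mult_left_mono[of "1/2" "1 - t" t] by simp
  then have "t * (1 - t * (1 - t)) \<le> t * (1 - t / 2)" using t by (intro mult_left_mono) auto
  also have "\<dots> \<le> s * (1 - s / 2)"
  proof -
    \<comment> \<open>The product equals \<open>s * (1 - s / 2) - t * (1 - t / 2)\<close>, so this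
      is monotonicity of the majorising map.\<close>
    have "0 \<le> (s - t) * (1 - (s + t) / 2)" using t s by (intro mult_nonneg_nonneg) auto
    then show ?thesis by (simp add: field_simps)
  qed
  also have "\<dots> \<le> 2 / (real (Suc n) + 2)"
    unfolding s_def by (simp add: divide_simps) (simp add: algebra_simps)
  finally show ?case unfolding eq using le_t t p by auto
qed simp

lemma exch_rate_tendsto_0: "exch_rate \<longlonglongrightarrow> 0"
proof (rule Lim_null_comparison)
  show "\<forall>\<^sub>F n in sequentially. norm (exch_rate n) \<le> 2 / (real n + 2)"
    using exch_rate_bounds by (intro always_eventually) simp
  show "(\<lambda>n. 2 / (real n + 2)) \<longlonglongrightarrow> 0"
    using LIMSEQ_ignore_initial_segment[OF lim_const_over_n[of "2::real"], of 2] by (simp add: add.commute)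
qed

context dilatation_monotone_Fatou
begin

text \<open>Off \<open>A\<close> the label \<open>f\<close> retains the value of \<open>Y\<close>,
  so averaging over its levels reproduces \<open>Y\<close> there a.s.; only the single level
  \<open>A\<close> is really averaged.\<close>

lemma rho_merge:
  assumes A: "A \<in> sets M" "prob A > 0" and Y: "simple_function M Y"
  shows "\<rho> (\<lambda>\<omega>. if \<omega> \<in> A then set_avg M A Y else Y \<omega>) \<le> \<rho> Y"
proof -
  define f where "f \<omega> = (if \<omega> \<in> A then None else Some (Y \<omega>))" for \<omega>
  have f: "simple_function M f"
    unfolding f_def using A sets.sets_into_space[OF A(1)] Y
    by (intro simple_function_If_set simple_function_const simple_function_compose1[where g=Some])
      (auto simp: Int_absorb2)
  have "AE \<omega> in M. (if \<omega> \<in> A then set_avg M A Y else Y \<omega>) = level_avg M f Y \<omega>"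
    using simple_level_null[OF f]
  proof eventually_elim
    case (elim \<omega>)
    show ?case
    proof (cases "\<omega> \<in> A")
      case True
      then have "f -` {f \<omega>} \<inter> space M = A"
        using sets.sets_into_space[OF A(1)] by (auto simp: f_def split: if_splits)
      then show ?thesis using True by (simp add: level_avg_def)
    next
      case False
      have "set_avg M (f -` {f \<omega>} \<inter> space M) Y = Y \<omega>"
      proof (rule set_avg_const[OF _ elim])
        show "Y \<omega>' = Y \<omega>" if "\<omega>' \<in> f -` {f \<omega>} \<inter> space M" for \<omega>'
          using that False by (auto simp: f_def split: if_splits)
      qed (rule simple_functionD(2)[OF f])
      then show ?thesis using False by (simp add: level_avg_def)
    qed
  qed
  then have "\<rho> (\<lambda>\<omega>. if \<omega> \<in> A then set_avg M A Y else Y \<omega>) = \<rho> (level_avg M f Y)"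
    using A Y f by (intro rho_cong_AE simple_in_S simple_update simple_level_avg)
  also have "\<dots> \<le> \<rho> Y" by (rule rho_level_avg[OF f simple_in_S[OF Y]])
  finally show ?thesis .
qed

definition exchangeable :: "real \<Rightarrow> bool" where
  "exchangeable t \<longleftrightarrow> (\<forall>A B x y Y. A \<in> sets M \<and> B \<in> sets M \<and> A \<inter> B = {} \<and> prob A = prob B \<and>
    simple_function M Y \<and> (\<forall>\<omega>\<in>A. Y \<omega> = x) \<and> (\<forall>\<omega>\<in>B. Y \<omega> = y) \<longrightarrow> \<rho> (exchange A B x y t Y) \<le> \<rho> Y)"

lemma exchangeableD:
  assumes "exchangeable t" "A \<in> sets M" "B \<in> sets M" "A \<inter> B = {}" "prob A = prob B"
    "simple_function M Y" "\<And>\<omega>. \<omega> \<in> A \<Longrightarrow> Y \<omega> = x" "\<And>\<omega>. \<omega> \<in> B \<Longrightarrow> Y \<omega> = y"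
  shows "\<rho> (exchange A B x y t Y) \<le> \<rho> Y"
  using assms(2-) by (intro assms(1)[unfolded exchangeable_def, rule_format]) simp

lemma exchangeableI:
  assumes "\<And>A B x y Y. A \<in> sets M \<Longrightarrow> B \<in> sets M \<Longrightarrow> A \<inter> B = {} \<Longrightarrow> prob A = prob B \<Longrightarrow> prob A > 0 \<Longrightarrow>
    simple_function M Y \<Longrightarrow> \<forall>\<omega>\<in>A. Y \<omega> = x \<Longrightarrow> \<forall>\<omega>\<in>B. Y \<omega> = y \<Longrightarrow> \<rho> (exchange A B x y t Y) \<le> \<rho> Y"
  shows "exchangeable t"
  unfolding exchangeable_def
proof (intro allI impI, elim conjE)
  fix A B :: "'a set" and x y :: real and Y :: "'a \<Rightarrow> real"
  assume A: "A \<in> sets M" "B \<in> sets M" "A \<inter> B = {}" "prob A = prob B"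
    and Y: "simple_function M Y" "\<forall>\<omega>\<in>A. Y \<omega> = x" "\<forall>\<omega>\<in>B. Y \<omega> = y"
  show "\<rho> (exchange A B x y t Y) \<le> \<rho> Y"
  proof (cases "prob A > 0")
    case True
    then show ?thesis by (intro assms[OF A _ Y])
  next
    case False
    then have "AE \<omega> in M. \<omega> \<notin> A" "AE \<omega> in M. \<omega> \<notin> B"
      using A by (auto intro!: AE_not_in_prob_0 simp: zero_less_measure_iff)
    then have "AE \<omega> in M. exchange A B x y t Y \<omega> = Y \<omega>"
      by eventually_elim (simp add: exchange_def)
    then have "\<rho> (exchange A B x y t Y) = \<rho> Y"
      using A Y by (intro rho_cong_AE simple_in_S simple_exchange)
    then show ?thesis by simp
  qed
qed

lemma exchangeable_half: "exchangeable (1 / 2)"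
proof (rule exchangeableI)
  fix A B :: "'a set" and x y :: real and Y :: "'a \<Rightarrow> real"
  assume A: "A \<in> sets M" "B \<in> sets M" "A \<inter> B = {}" "prob A = prob B" "prob A > 0"
    and Y: "simple_function M Y" "\<forall>\<omega>\<in>A. Y \<omega> = x" "\<forall>\<omega>\<in>B. Y \<omega> = y"
  have "set_avg M (A \<union> B) Y = (x + y) / 2" using A Y by (intro set_avg_two) auto
  then have "exchange A B x y (1 / 2) Y = (\<lambda>\<omega>. if \<omega> \<in> A \<union> B then set_avg M (A \<union> B) Y else Y \<omega>)"
    by (auto simp: exchange_def fun_eq_iff field_simps)
  moreover have "prob (A \<union> B) > 0" using A by (simp add: finite_measure_Union)
  ultimately show "\<rho> (exchange A B x y (1 / 2) Y) \<le> \<rho> Y"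
    using rho_merge[of "A \<union> B" Y] A Y by simp
qed

text \<open>
  Halve \<open>A\<close> and \<open>B\<close>, let each half of \<open>A\<close> pass both halves of \<open>B\<close> in turn, and average over \<open>A\<close>
  and over \<open>B\<close> at the end.
\<close>

lemma exchangeable_step:
  assumes t: "exchangeable t"
  shows "exchangeable (t - t\<^sup>2 + t ^ 3)"
proof (rule exchangeableI)
  fix A B :: "'a set" and x y :: real and Y :: "'a \<Rightarrow> real"
  assume A: "A \<in> sets M" "B \<in> sets M" "A \<inter> B = {}" "prob A = prob B" "prob A > 0"
    and Y: "simple_function M Y" "\<forall>\<omega>\<in>A. Y \<omega> = x" "\<forall>\<omega>\<in>B. Y \<omega> = y"
  obtain A1 where A1: "A1 \<in> sets M" "A1 \<subseteq> A" "prob A1 = prob A / 2"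
    by (rule nonatomic_subset[OF na A(1), of "prob A / 2"]) auto
  obtain B1 where B1: "B1 \<in> sets M" "B1 \<subseteq> B" "prob B1 = prob B / 2"
    by (rule nonatomic_subset[OF na A(2), of "prob B / 2"]) auto
  define A2 B2 where "A2 = A - A1" and "B2 = B - B1"
  have A2: "A2 \<in> sets M" "A2 \<subseteq> A" "A1 \<inter> A2 = {}" "A = A1 \<union> A2" "prob A2 = prob A / 2"
    using A A1 by (auto simp: A2_def finite_measure_Diff)
  have B2: "B2 \<in> sets M" "B2 \<subseteq> B" "B1 \<inter> B2 = {}" "B = B1 \<union> B2" "prob B2 = prob B / 2"
    using A B1 by (auto simp: B2_def finite_measure_Diff)
  note p = A1(3) A2(5) B1(3) B2(5) A(4)
  note sets = A(1,2) A1(1) A2(1) B1(1) B2(1)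
  \<comment> \<open>Values at the four contacts, in the order of \<open>Y1\<close> to
    \<open>Y4\<close>; a prime marks the value of a piece after the second of its two contacts. For
    \<open>x = 1\<close> and \<open>y = 0\<close> one gets \<open>a1' = t^2\<close> and
    \<open>a2' = 2*t - 3*t^2 + 2*t^3\<close>, whose mean is the new rate.\<close>
  define a1 b1 where "a1 = y + t * (x - y)" and "b1 = x - t * (x - y)"
  define a1' b2 where "a1' = y + t * (a1 - y)" and "b2 = a1 - t * (a1 - y)"
  define a2 b1' where "a2 = b1 + t * (x - b1)" and "b1' = x - t * (x - b1)"
  define a2' b2' where "a2' = b2 + t * (a2 - b2)" and "b2' = a2 - t * (a2 - b2)"
  define Y1 where "Y1 = exchange A1 B1 x y t Y"
  define Y2 where "Y2 = exchange A1 B2 a1 y t Y1"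
  define Y3 where "Y3 = exchange A2 B1 x b1 t Y2"
  define Y4 where "Y4 = exchange A2 B2 a2 b2 t Y3"
  define Y5 where "Y5 = (\<lambda>\<omega>. if \<omega> \<in> A then set_avg M A Y4 else Y4 \<omega>)"
  define Y6 where "Y6 = (\<lambda>\<omega>. if \<omega> \<in> B then set_avg M B Y5 else Y5 \<omega>)"
  have s1: "simple_function M Y1" unfolding Y1_def by (intro simple_exchange sets Y(1))
  have s2: "simple_function M Y2" unfolding Y2_def by (intro simple_exchange sets s1)
  have s3: "simple_function M Y3" unfolding Y3_def by (intro simple_exchange sets s2)
  have s4: "simple_function M Y4" unfolding Y4_def by (intro simple_exchange sets s3)
  have s5: "simple_function M Y5" unfolding Y5_def by (intro simple_update sets s4)
  have disj: "\<omega> \<in> A1 \<Longrightarrow> \<omega> \<notin> A2 \<and> \<omega> \<notin> B1 \<and> \<omega> \<notin> B2" "\<omega> \<in> A2 \<Longrightarrow> \<omega> \<notin> A1 \<and> \<omega> \<notin> B1 \<and> \<omega> \<notin> B2"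
    "\<omega> \<in> B1 \<Longrightarrow> \<omega> \<notin> A1 \<and> \<omega> \<notin> A2 \<and> \<omega> \<notin> B2" "\<omega> \<in> B2 \<Longrightarrow> \<omega> \<notin> A1 \<and> \<omega> \<notin> A2 \<and> \<omega> \<notin> B1" for \<omega>
    using A(3) A1(2) A2(2,3) B1(2) B2(2,3) by blast+
  have dj: "A1 \<inter> B1 = {}" "A1 \<inter> B2 = {}" "A2 \<inter> B1 = {}" "A2 \<inter> B2 = {}"
    using A(3) A1(2) A2(2) B1(2) B2(2) by blast+
  \<comment> \<open>A single label for the four pieces and the rest: that membership in one piece
    excludes the others becomes distinctness of labels.\<close>
  define c :: "'a \<Rightarrow> nat" where
    "c \<omega> = (if \<omega> \<in> A1 then 1 else if \<omega> \<in> A2 then 2 else if \<omega> \<in> B1 then 3 else if \<omega> \<in> B2 then 4 else 0)" for \<omega>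
  have "(\<omega> \<in> A1 \<longleftrightarrow> c \<omega> = 1) \<and> (\<omega> \<in> A2 \<longleftrightarrow> c \<omega> = 2) \<and> (\<omega> \<in> B1 \<longleftrightarrow> c \<omega> = 3) \<and> (\<omega> \<in> B2 \<longleftrightarrow> c \<omega> = 4)" for \<omega>
  proof -
    consider "\<omega> \<in> A1" | "\<omega> \<in> A2" | "\<omega> \<in> B1" | "\<omega> \<in> B2" | "\<omega> \<notin> A1 \<and> \<omega> \<notin> A2 \<and> \<omega> \<notin> B1 \<and> \<omega> \<notin> B2"
      by blast
    then show ?thesis
    proof cases
      case 1 from disj(1)[OF 1] 1 show ?thesis by (simp add: c_def)
    next
      case 2 from disj(2)[OF 2] 2 show ?thesis by (simp add: c_def)
    next
      case 3 from disj(3)[OF 3] 3 show ?thesis by (simp add: c_def)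
    next
      case 4 from disj(4)[OF 4] 4 show ?thesis by (simp add: c_def)
    qed (simp add: c_def)
  qed
  then have c: "\<omega> \<in> A1 \<longleftrightarrow> c \<omega> = 1" "\<omega> \<in> A2 \<longleftrightarrow> c \<omega> = 2" "\<omega> \<in> B1 \<longleftrightarrow> c \<omega> = 3" "\<omega> \<in> B2 \<longleftrightarrow> c \<omega> = 4" for \<omega>
    by blast+
  have v0: "\<omega> \<in> A1 \<Longrightarrow> Y \<omega> = x" "\<omega> \<in> A2 \<Longrightarrow> Y \<omega> = x" "\<omega> \<in> B1 \<Longrightarrow> Y \<omega> = y" "\<omega> \<in> B2 \<Longrightarrow> Y \<omega> = y" for \<omega>
    using Y(2,3) A1(2) A2(2) B1(2) B2(2) by blast+
  have v1: "\<omega> \<in> A1 \<Longrightarrow> Y1 \<omega> = a1" "\<omega> \<in> A2 \<Longrightarrow> Y1 \<omega> = x" "\<omega> \<in> B1 \<Longrightarrow> Y1 \<omega> = b1" "\<omega> \<in> B2 \<Longrightarrow> Y1 \<omega> = y" for \<omega>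
    using v0[of \<omega>] by (simp_all add: Y1_def exchange_def a1_def b1_def c)
  have v2: "\<omega> \<in> A1 \<Longrightarrow> Y2 \<omega> = a1'" "\<omega> \<in> A2 \<Longrightarrow> Y2 \<omega> = x" "\<omega> \<in> B1 \<Longrightarrow> Y2 \<omega> = b1" "\<omega> \<in> B2 \<Longrightarrow> Y2 \<omega> = b2" for \<omega>
    using v1[of \<omega>] by (simp_all add: Y2_def exchange_def a1'_def b2_def c)
  have v3: "\<omega> \<in> A1 \<Longrightarrow> Y3 \<omega> = a1'" "\<omega> \<in> A2 \<Longrightarrow> Y3 \<omega> = a2" "\<omega> \<in> B1 \<Longrightarrow> Y3 \<omega> = b1'" "\<omega> \<in> B2 \<Longrightarrow> Y3 \<omega> = b2" for \<omega>
    using v2[of \<omega>] by (simp_all add: Y3_def exchange_def a2_def b1'_def c)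
  have v4: "\<omega> \<in> A1 \<Longrightarrow> Y4 \<omega> = a1'" "\<omega> \<in> A2 \<Longrightarrow> Y4 \<omega> = a2'" "\<omega> \<in> B1 \<Longrightarrow> Y4 \<omega> = b1'" "\<omega> \<in> B2 \<Longrightarrow> Y4 \<omega> = b2'" for \<omega>
    using v3[of \<omega>] by (simp_all add: Y4_def exchange_def a2'_def b2'_def c)
  have avgA: "set_avg M A Y4 = (a1' + a2') / 2"
    unfolding A2(4) using A(5) A1(3) A2(5)
    by (intro set_avg_two[OF A1(1) A2(1,3) _ _ s4 v4(1,2)]) auto
  have v5: "\<omega> \<in> B1 \<Longrightarrow> Y5 \<omega> = b1'" "\<omega> \<in> B2 \<Longrightarrow> Y5 \<omega> = b2'" for \<omega>
    using v4[of \<omega>] by (simp_all add: Y5_def A2(4) c)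
  have avgB: "set_avg M B Y5 = (b1' + b2') / 2"
    unfolding B2(4) using A(4,5) B1(3) B2(5)
    by (intro set_avg_two[OF B1(1) B2(1,3) _ _ s5 v5]) auto
  have "\<rho> Y1 \<le> \<rho> Y" unfolding Y1_def
    by (rule exchangeableD[OF t A1(1) B1(1) dj(1) _ Y(1) v0(1,3)]) (simp_all add: p)
  moreover have "\<rho> Y2 \<le> \<rho> Y1" unfolding Y2_def
    by (rule exchangeableD[OF t A1(1) B2(1) dj(2) _ s1 v1(1,4)]) (simp_all add: p)
  moreover have "\<rho> Y3 \<le> \<rho> Y2" unfolding Y3_def
    by (rule exchangeableD[OF t A2(1) B1(1) dj(3) _ s2 v2(2,3)]) (simp_all add: p)
  moreover have "\<rho> Y4 \<le> \<rho> Y3" unfolding Y4_def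
    by (rule exchangeableD[OF t A2(1) B2(1) dj(4) _ s3 v3(2,4)]) (simp_all add: p)
  moreover have "\<rho> Y5 \<le> \<rho> Y4" unfolding Y5_def using A s4 by (intro rho_merge)
  moreover have "\<rho> Y6 \<le> \<rho> Y5" unfolding Y6_def using A s5 by (intro rho_merge) auto
  moreover have "Y6 = exchange A B x y (t - t\<^sup>2 + t ^ 3) Y"
  proof
    fix \<omega>
    have eqA: "(a1' + a2') / 2 = y + (t - t\<^sup>2 + t ^ 3) * (x - y)"
      by (simp add: a1'_def a2'_def a1_def a2_def b1_def b2_def field_simps power2_eq_square power3_eq_cube)
    have eqB: "(b1' + b2') / 2 = x - (t - t\<^sup>2 + t ^ 3) * (x - y)"
      by (simp add: b1'_def b2'_def a1_def a2_def b1_def b2_def field_simps power2_eq_square power3_eq_cube)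
    have out: "Y4 \<omega> = Y \<omega>" if "\<omega> \<notin> A" "\<omega> \<notin> B"
      using that A2(4) B2(4) by (simp add: Y4_def Y3_def Y2_def Y1_def exchange_def)
    show "Y6 \<omega> = exchange A B x y (t - t\<^sup>2 + t ^ 3) Y \<omega>"
      using A(3) out by (auto simp: Y6_def Y5_def exchange_def avgA avgB[unfolded Y5_def] eqA eqB)
  qed
  ultimately show "\<rho> (exchange A B x y (t - t\<^sup>2 + t ^ 3) Y) \<le> \<rho> Y" by auto
qed

lemma exchangeable_rate: "exchangeable (exch_rate n)"
proof (induction n)
  case 0
  show ?case using exchangeable_half by simp
next
  case (Suc n)
  then show ?case using exchangeable_step by simp
qed

lemma exchangeable_0: "exchangeable 0"
proof (rule exchangeableI)
  fix A B :: "'a set" and x y :: real and Y :: "'a \<Rightarrow> real"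
  assume A: "A \<in> sets M" "B \<in> sets M" "A \<inter> B = {}" "prob A = prob B" "prob A > 0"
    and Y: "simple_function M Y" "\<forall>\<omega>\<in>A. Y \<omega> = x" "\<forall>\<omega>\<in>B. Y \<omega> = y"
  obtain K where K: "\<And>\<omega>. \<omega> \<in> space M \<Longrightarrow> \<bar>Y \<omega>\<bar> \<le> K"
    using finite_imp_bounded[OF simple_functionD(1)[OF Y(1)]] by (auto simp: bounded_iff)
  have "\<rho> (exchange A B x y 0 Y) \<le> liminf (\<lambda>n. \<rho> (exchange A B x y (exch_rate n) Y))"
  proof (rule Fatou_simple)
    show "simple_function M (exchange A B x y (exch_rate n) Y)" for n by (intro simple_exchange A Y)
    show "simple_function M (exchange A B x y 0 Y)" by (intro simple_exchange A Y)
    fix \<omega> assume \<omega>: "\<omega> \<in> space M"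
    show "(\<lambda>n. exchange A B x y (exch_rate n) Y \<omega>) \<longlonglongrightarrow> exchange A B x y 0 Y \<omega>"
    proof -
      have *: "(\<lambda>n. exch_rate n * (x - y)) \<longlonglongrightarrow> 0 * (x - y)"
        by (intro tendsto_mult exch_rate_tendsto_0 tendsto_const)
      show ?thesis
        using tendsto_add[OF tendsto_const * , of y] tendsto_diff[OF tendsto_const * , of x]
        by (simp add: exchange_def)
    qed
    fix n
    have "\<bar>exch_rate n * (x - y)\<bar> \<le> 1 * \<bar>x - y\<bar>"
      unfolding abs_mult using exch_rate_bounds[of n] by (intro mult_right_mono) auto
    then show "\<bar>exchange A B x y (exch_rate n) Y \<omega>\<bar> \<le> \<bar>K\<bar> + \<bar>x\<bar> + \<bar>y\<bar> + \<bar>x - y\<bar>"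
      using K[OF \<omega>] by (auto simp: exchange_def)
  qed
  also have "\<dots> \<le> liminf (\<lambda>n::nat. \<rho> Y)"
  proof (intro Liminf_mono always_eventually allI)
    show "\<rho> (exchange A B x y (exch_rate n) Y) \<le> \<rho> Y" for n
      using Y by (intro exchangeableD[OF exchangeable_rate A(1-4) Y(1)]) auto
  qed
  also have "\<dots> = \<rho> Y" by (simp add: Liminf_const)
  finally show "\<rho> (exchange A B x y 0 Y) \<le> \<rho> Y" .
qed

end

section \<open>Law invariance\<close>

context prob_space
begin

text \<open>The average over a set defined by the values of \<open>X\<close> is a quantity of the
  law of \<open>X\<close>; this is how equality of laws enters.\<close>

lemma set_avg_distr:
  assumes X: "integrable M X" and D: "D \<in> sets borel"
  shows "set_avg M (X -` D \<inter> space M) X = set_avg (distr M borel X) D (\<lambda>x. x)"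
proof -
  have [measurable]: "X \<in> borel_measurable M" "D \<in> sets borel" using X D by auto
  have "(LINT x:D|distr M borel X. x) = (\<integral>\<omega>. indicator D (X \<omega>) * X \<omega> \<partial>M)"
    unfolding set_lebesgue_integral_def by (subst integral_distr) simp_all
  also have "\<dots> = (LINT \<omega>:X -` D \<inter> space M|M. X \<omega>)"
    unfolding set_lebesgue_integral_def
    by (intro Bochner_Integration.integral_cong) (auto simp: indicator_def)
  finally show ?thesis by (simp add: set_avg_def measure_distr)
qed

end

text \<open>One index governs both the threshold \<open>n\<close> and the mesh
  \<open>1 / (n + 1)\<close>. The tail is a cell by itself, so the label is a function of the value
  alone and the discretised variable is determined in law by the law of \<open>X\<close>.\<close>

definition discretise :: "nat \<Rightarrow> real \<Rightarrow> int option" where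
  "discretise n x = (if \<bar>x\<bar> > real n then None else Some \<lfloor>x * real (Suc n)\<rfloor>)"

lemma measurable_discretise [measurable]: "discretise n \<in> measurable borel (count_space UNIV)"
  unfolding discretise_def[abs_def] by measurable

lemma vimage_discretise: "discretise n -` T \<in> sets borel"
  using measurable_sets[OF measurable_discretise[of n], of T] by simp

context prob_space
begin

text \<open>Outside \<open>A \<union> B\<close> nothing changes, and the two sets contribute equal
  probabilities to the levels that they trade.\<close>

lemma prob_swap:
  fixes Y :: "'a \<Rightarrow> real"
  assumes A: "A \<in> sets M" "B \<in> sets M" "A \<inter> B = {}" "prob A = prob B"
    and Y: "simple_function M Y" "\<And>\<omega>. \<omega> \<in> A \<Longrightarrow> Y \<omega> = x" "\<And>\<omega>. \<omega> \<in> B \<Longrightarrow> Y \<omega> = y"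
  defines "Y' \<equiv> \<lambda>\<omega>. if \<omega> \<in> A then y else if \<omega> \<in> B then x else Y \<omega>"
  shows "prob (Y' -` {v} \<inter> space M) = prob (Y -` {v} \<inter> space M)"
proof -
  have Y's: "simple_function M Y'" unfolding Y'_def by (intro simple_update A Y)
  have sub: "A \<subseteq> space M" "B \<subseteq> space M" using A sets.sets_into_space by auto
  have split: "prob (Z -` {v} \<inter> space M) = prob (Z -` {v} \<inter> space M - (A \<union> B)) +
      (if a = v then prob A else 0) + (if b = v then prob B else 0)"
    if Z: "simple_function M Z" "\<And>\<omega>. \<omega> \<in> A \<Longrightarrow> Z \<omega> = a" "\<And>\<omega>. \<omega> \<in> B \<Longrightarrow> Z \<omega> = b" for Z a b
  proof -
    let ?R = "Z -` {v} \<inter> space M - (A \<union> B)"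
    have R: "?R \<in> sets M" using simple_functionD(2)[OF Z(1)] A by blast
    have "Z -` {v} \<inter> space M = ?R \<union> ((if a = v then A else {}) \<union> (if b = v then B else {}))"
      using Z(2,3) sub by (auto split: if_splits)
    also have "prob \<dots> = prob ?R + prob ((if a = v then A else {}) \<union> (if b = v then B else {}))"
      using R A by (intro finite_measure_Union) auto
    also have "prob ((if a = v then A else {}) \<union> (if b = v then B else {})) =
        prob (if a = v then A else {}) + prob (if b = v then B else {})"
      using A by (intro finite_measure_Union) auto
    finally show ?thesis by simp
  qed
  have "Y' -` {v} \<inter> space M - (A \<union> B) = Y -` {v} \<inter> space M - (A \<union> B)" by (auto simp: Y'_def)
  moreover have "\<omega> \<in> A \<Longrightarrow> Y' \<omega> = y" "\<omega> \<in> B \<Longrightarrow> Y' \<omega> = x" for \<omega>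
    using A(3) by (auto simp: Y'_def)
  ultimately show ?thesis
    using split[OF Y's, of y x] split[OF Y(1), of x y] Y(2,3) A(4) by simp
qed

lemma simple_discretise_comp:
  assumes "integrable M X"
  shows "simple_function M (\<lambda>\<omega>. discretise n (X \<omega>))"
  using simple_discretise[of X M "{}" n "Suc n"] assms by (simp add: discretise_def[abs_def])

lemma level_avg_discretise:
  assumes "integrable M X"
  shows "level_avg M (\<lambda>\<omega>. discretise n (X \<omega>)) X \<omega> =
    set_avg (distr M borel X) (discretise n -` {discretise n (X \<omega>)}) (\<lambda>x. x)"
proof -
  have "(\<lambda>\<omega>. discretise n (X \<omega>)) -` {discretise n (X \<omega>)} = X -` discretise n -` {discretise n (X \<omega>)}"
    by auto
  then show ?thesis using set_avg_distr[OF assms vimage_discretise] by (simp add: level_avg_def)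
qed

text \<open>Off the tail the error is at most the mesh. On the tail it is at most
  \<open>\<bar>X\<bar>\<close> plus the mean of \<open>\<bar>X\<bar>\<close> over the tail, and each
  of these integrates there to the tail integral; hence the factor 2.\<close>

lemma level_avg_discretise_L1:
  assumes X: "integrable M X"
  shows "(\<lambda>n. \<integral>\<omega>. \<bar>level_avg M (\<lambda>\<omega>. discretise n (X \<omega>)) X \<omega> - X \<omega>\<bar> \<partial>M) \<longlonglongrightarrow> 0"
proof (rule Lim_null_comparison)
  have [measurable]: "X \<in> borel_measurable M" using X by auto
  define T where "T n = {\<omega>\<in>space M. \<bar>X \<omega>\<bar> > real n}" for n
  have T: "T n \<in> sets M" for n unfolding T_def by measurable
  have iA: "integrable M (\<lambda>\<omega>. \<bar>X \<omega>\<bar>)" using X by simp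
  define tail where "tail n = (LINT \<omega>:T n|M. \<bar>X \<omega>\<bar>)" for n
  define m where "m n = set_avg M (T n) (\<lambda>\<omega>. \<bar>X \<omega>\<bar>)" for n
  have m: "m n * prob (T n) = tail n" for n unfolding m_def tail_def by (rule set_avg_mult[OF T])
  show "\<forall>\<^sub>F n in sequentially.
      norm (\<integral>\<omega>. \<bar>level_avg M (\<lambda>\<omega>. discretise n (X \<omega>)) X \<omega> - X \<omega>\<bar> \<partial>M) \<le> 1 / real (Suc n) + 2 * tail n"
  proof (intro always_eventually allI)
    fix n
    let ?f = "\<lambda>\<omega>. discretise n (X \<omega>)"
    let ?Z = "level_avg M ?f X"
    have f: "simple_function M ?f" by (rule simple_discretise_comp[OF X])
    have Z: "integrable M ?Z" by (intro integrable_simple simple_level_avg f)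
    have i: "integrable M (\<lambda>\<omega>. indicator (T n) \<omega> * \<bar>X \<omega>\<bar>)" "integrable M (\<lambda>\<omega>. indicator (T n) \<omega> * m n)"
      using integrable_mult_indicator[OF T iA] integrable_mult_indicator[OF T, of "\<lambda>_. m n"] by auto
    have "AE \<omega> in M. \<bar>?Z \<omega> - X \<omega>\<bar> \<le> 1 / real (Suc n) + (indicator (T n) \<omega> * \<bar>X \<omega>\<bar> + indicator (T n) \<omega> * m n)"
      using AE_level_avg_close[OF f X] AE_space
    proof eventually_elim
      case (elim \<omega>)
      show ?case
      proof (cases "\<omega> \<in> T n")
        case True
        have "?f -` {?f \<omega>} \<inter> space M = T n"
          using True by (auto simp: T_def discretise_def split: if_splits)
        then have "\<bar>?Z \<omega>\<bar> \<le> m n"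
          using abs_set_avg_le[OF T X] by (simp add: level_avg_def m_def)
        then have "\<bar>?Z \<omega> - X \<omega>\<bar> \<le> \<bar>X \<omega>\<bar> + m n" by linarith
        moreover have "0 \<le> 1 / real (Suc n)" by simp
        ultimately have "\<bar>?Z \<omega> - X \<omega>\<bar> \<le> 1 / real (Suc n) + (\<bar>X \<omega>\<bar> + m n)" by linarith
        then show ?thesis using True by simp
      next
        case False
        have "\<bar>?Z \<omega> - X \<omega>\<bar> \<le> 1 / real (Suc n)"
        proof (rule elim(1)[rule_format])
          fix \<omega>' assume "\<omega>' \<in> space M" "?f \<omega>' = ?f \<omega>"
          then show "\<bar>X \<omega>' - X \<omega>\<bar> \<le> 1 / real (Suc n)"
            using False elim(2)
            by (intro floor_scale_close) (auto simp: T_def discretise_def simp del: of_nat_Suc split: if_splits)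
        qed
        then show ?thesis using False by simp
      qed
    qed
    then have "(\<integral>\<omega>. \<bar>?Z \<omega> - X \<omega>\<bar> \<partial>M) \<le>
        (\<integral>\<omega>. 1 / real (Suc n) + (indicator (T n) \<omega> * \<bar>X \<omega>\<bar> + indicator (T n) \<omega> * m n) \<partial>M)"
      using Z X i by (intro integral_mono_AE) auto
    also have "\<dots> = 1 / real (Suc n) + (tail n + prob (T n) * m n)"
      using i T by (simp add: tail_def set_lebesgue_integral_def prob_space del: of_nat_Suc)
    finally show "norm (\<integral>\<omega>. \<bar>?Z \<omega> - X \<omega>\<bar> \<partial>M) \<le> 1 / real (Suc n) + 2 * tail n"
      using m[of n] by (simp add: mult.commute del: of_nat_Suc)
  qed
  have "tail \<longlonglongrightarrow> 0" unfolding tail_def[abs_def] T_def by (rule tail_integral_tendsto_0[OF X])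
  then have "(\<lambda>n. 1 / real (Suc n) + 2 * tail n) \<longlonglongrightarrow> 0 + 2 * 0"
    by (intro tendsto_add tendsto_mult tendsto_const LIMSEQ_Suc[OF lim_const_over_n])
  then show "(\<lambda>n. 1 / real (Suc n) + 2 * tail n) \<longlonglongrightarrow> 0" by simp
qed

end

context dilatation_monotone_Fatou
begin

section \<open>Rearrangement of simple random variables by interchanges\<close>

lemma rho_swap:
  assumes A: "A \<in> sets M" "B \<in> sets M" "A \<inter> B = {}" "prob A = prob B"
    and Y: "simple_function M Y" "\<And>\<omega>. \<omega> \<in> A \<Longrightarrow> Y \<omega> = x" "\<And>\<omega>. \<omega> \<in> B \<Longrightarrow> Y \<omega> = y"
  shows "\<rho> (\<lambda>\<omega>. if \<omega> \<in> A then y else if \<omega> \<in> B then x else Y \<omega>) \<le> \<rho> Y"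
proof -
  have "exchange A B x y 0 Y = (\<lambda>\<omega>. if \<omega> \<in> A then y else if \<omega> \<in> B then x else Y \<omega>)"
    by (simp add: exchange_def fun_eq_iff)
  then show ?thesis using exchangeableD[OF exchangeable_0 A Y] by simp
qed

text \<open>The interchanges that move the value \<open>a\<close> from \<open>W\<close> to \<open>U\<close>, one value of \<open>Y\<close> on \<open>U\<close> at a time.\<close>

lemma rho_transport:
  assumes "finite V"
  shows "\<And>U W Y. U \<in> sets M \<Longrightarrow> W \<in> sets M \<Longrightarrow> U \<inter> W = {} \<Longrightarrow> prob U = prob W \<Longrightarrow>
    simple_function M Y \<Longrightarrow> (\<And>\<omega>. \<omega> \<in> W \<Longrightarrow> Y \<omega> = a) \<Longrightarrow> (\<And>\<omega>. \<omega> \<in> U \<Longrightarrow> Y \<omega> \<in> V) \<Longrightarrow>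
    \<exists>Y'. simple_function M Y' \<and> (\<forall>\<omega>\<in>U. Y' \<omega> = a) \<and> (AE \<omega> in M. \<omega> \<in> W \<longrightarrow> Y' \<omega> \<in> V) \<and>
      (\<forall>\<omega>. \<omega> \<notin> U \<and> \<omega> \<notin> W \<longrightarrow> Y' \<omega> = Y \<omega>) \<and>
      (\<forall>v. prob (Y' -` {v} \<inter> space M) = prob (Y -` {v} \<inter> space M)) \<and> \<rho> Y' \<le> \<rho> Y"
  using assms
proof (induction V)
  case empty
  \<comment> \<open>Here \<open>W\<close> is null but perhaps not empty, and \<open>Y\<close> still
    has the value \<open>a\<close> on it. This is why the values on \<open>W\<close> are controlled
    only a.s.\<close>
  then have "U = {}" by blast
  then have "AE \<omega> in M. \<omega> \<notin> W" using empty by (intro AE_not_in_prob_0) auto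
  then show ?case using empty.prems(5) \<open>U = {}\<close> by (intro exI[of _ Y]) simp
next
  case (insert b V)
  note UW = insert.prems(1-4) and Y = insert.prems(5-7)
  define Ub where "Ub = U \<inter> (Y -` {b} \<inter> space M)"
  have Ub: "Ub \<in> sets M" "Ub \<subseteq> U" using UW(1) simple_functionD(2)[OF Y(1)] by (auto simp: Ub_def)
  have "prob Ub \<le> prob W" unfolding UW(4)[symmetric] by (rule finite_measure_mono[OF Ub(2) UW(1)])
  then obtain Wb where Wb: "Wb \<in> sets M" "Wb \<subseteq> W" "prob Wb = prob Ub"
    by (rule nonatomic_subset[OF na UW(2) measure_nonneg])
  have dj: "Ub \<inter> Wb = {}" using Ub(2) Wb(2) UW(3) by blast
  define Y1 where "Y1 = (\<lambda>\<omega>. if \<omega> \<in> Ub then a else if \<omega> \<in> Wb then b else Y \<omega>)"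
  have vb: "\<And>\<omega>. \<omega> \<in> Ub \<Longrightarrow> Y \<omega> = b" "\<And>\<omega>. \<omega> \<in> Wb \<Longrightarrow> Y \<omega> = a"
    using Y(2) Wb(2) by (auto simp: Ub_def)
  have s1: "simple_function M Y1" unfolding Y1_def by (intro simple_update Ub Wb Y)
  have r1: "\<rho> Y1 \<le> \<rho> Y" unfolding Y1_def
    by (rule rho_swap[OF Ub(1) Wb(1) dj Wb(3)[symmetric] Y(1) vb])
  have p1: "prob (Y1 -` {v} \<inter> space M) = prob (Y -` {v} \<inter> space M)" for v
    unfolding Y1_def by (rule prob_swap[OF Ub(1) Wb(1) dj Wb(3)[symmetric] Y(1) vb])
  have 1: "U - Ub \<in> sets M" "W - Wb \<in> sets M" "(U - Ub) \<inter> (W - Wb) = {}" using UW Ub Wb by auto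
  have 2: "prob (U - Ub) = prob (W - Wb)" using UW Ub Wb by (simp add: finite_measure_Diff)
  have 3: "Y1 \<omega> = a" if "\<omega> \<in> W - Wb" for \<omega>
    using that UW(3) Ub(2) Y(2) by (auto simp: Y1_def)
  have 4: "Y1 \<omega> \<in> V" if "\<omega> \<in> U - Ub" for \<omega>
  proof -
    have "\<omega> \<in> space M" using that UW(1) sets.sets_into_space by blast
    then have "Y \<omega> \<noteq> b" using that by (auto simp: Ub_def)
    moreover have "\<omega> \<notin> Wb" using that UW(3) Wb(2) by blast
    ultimately show ?thesis using that Y(3)[of \<omega>] by (simp add: Y1_def)
  qed
  obtain Y' where Y': "simple_function M Y'" "\<forall>\<omega>\<in>U - Ub. Y' \<omega> = a"
    "AE \<omega> in M. \<omega> \<in> W - Wb \<longrightarrow> Y' \<omega> \<in> V"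
    "\<forall>\<omega>. \<omega> \<notin> U - Ub \<and> \<omega> \<notin> W - Wb \<longrightarrow> Y' \<omega> = Y1 \<omega>"
    "\<forall>v. prob (Y' -` {v} \<inter> space M) = prob (Y1 -` {v} \<inter> space M)" "\<rho> Y' \<le> \<rho> Y1"
    using insert.IH[OF 1 2 s1 3 4] by blast
  have out: "Y' \<omega> = Y1 \<omega>" if "\<omega> \<in> Ub \<or> \<omega> \<in> Wb \<or> \<omega> \<notin> U \<and> \<omega> \<notin> W" for \<omega>
    using that UW(3) Ub(2) Wb(2) by (intro Y'(4)[rule_format]) blast
  show ?case
  proof (intro exI conjI ballI allI impI)
    show "simple_function M Y'" by (rule Y'(1))
    show "Y' \<omega> = a" if "\<omega> \<in> U" for \<omega>
      using that Y'(2) out[of \<omega>] by (cases "\<omega> \<in> Ub") (auto simp: Y1_def)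
    show "AE \<omega> in M. \<omega> \<in> W \<longrightarrow> Y' \<omega> \<in> insert b V"
      using Y'(3)
    proof eventually_elim
      case (elim \<omega>)
      show ?case
      proof
        assume "\<omega> \<in> W"
        then show "Y' \<omega> \<in> insert b V"
          using elim out[of \<omega>] dj by (cases "\<omega> \<in> Wb") (auto simp: Y1_def)
      qed
    qed
    show "Y' \<omega> = Y \<omega>" if "\<omega> \<notin> U \<and> \<omega> \<notin> W" for \<omega>
      using that out[of \<omega>] Ub(2) Wb(2) by (auto simp: Y1_def)
    show "prob (Y' -` {v} \<inter> space M) = prob (Y -` {v} \<inter> space M)" for v
      using Y'(5) p1 by simp
    show "\<rho> Y' \<le> \<rho> Y" using Y'(6) r1 by (rule order_trans)
  qed
qed

text \<open>
  Each step corrects \<open>Y\<close> on the whole level set \<open>{X = a}\<close>; later steps only interchange other values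
  and do not spoil this.
\<close>

lemma rho_le_of_simple_rearrangement:
  assumes X: "simple_function M X" and "finite V"
  shows "\<And>Y. simple_function M Y \<Longrightarrow>
    (\<And>v. prob (Y -` {v} \<inter> space M) = prob (X -` {v} \<inter> space M)) \<Longrightarrow>
    AE \<omega> in M. X \<omega> = Y \<omega> \<or> X \<omega> \<in> V \<and> Y \<omega> \<in> V \<Longrightarrow> \<rho> X \<le> \<rho> Y"
  using \<open>finite V\<close>
proof (induction V)
  case empty
  then have "\<rho> X = \<rho> Y" using X by (intro rho_cong_AE simple_in_S) auto
  then show ?case by simp
next
  case (insert a V)
  note Y = insert.prems(1) and law = insert.prems(2) and AE = insert.prems(3)
  \<comment> \<open>\<open>U\<close> is where \<open>Y\<close> lacks the value \<open>a\<close> and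
    \<open>W\<close> is where it has it in excess. Requiring \<open>Y\<close> to lie in
    \<open>V - {a}\<close> discards only a null set and gives the pointwise condition that
    \<open>rho_transport\<close> asks for; equality of laws makes both sets equally
    probable.\<close>
  define U where "U = (X -` {a} \<inter> space M) \<inter> (Y -` (V - {a}) \<inter> space M)"
  define W where "W = (Y -` {a} \<inter> space M) - (X -` {a} \<inter> space M)"
  note mX = simple_functionD(2)[OF X] and mY = simple_functionD(2)[OF Y]
  have UW: "U \<in> sets M" "W \<in> sets M" using mX mY by (auto simp: U_def W_def)
  have dj: "U \<inter> W = {}" by (auto simp: U_def W_def)
  let ?I = "(X -` {a} \<inter> space M) \<inter> (Y -` {a} \<inter> space M)"
  have I: "?I \<in> sets M" using mX mY by blast
  have "prob U = prob (X -` {a} \<inter> space M - ?I)"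
  proof (rule finite_measure_eq_AE)
    show "AE \<omega> in M. (\<omega> \<in> U) = (\<omega> \<in> X -` {a} \<inter> space M - ?I)"
      using AE by eventually_elim (auto simp: U_def)
  qed (use UW I mX in auto)
  also have "\<dots> = prob (X -` {a} \<inter> space M) - prob ?I"
    using I mX by (intro finite_measure_Diff) auto
  also have "\<dots> = prob (Y -` {a} \<inter> space M) - prob ?I" by (simp add: law)
  also have "\<dots> = prob (Y -` {a} \<inter> space M - ?I)"
    using I mY by (intro finite_measure_Diff[symmetric]) auto
  also have "Y -` {a} \<inter> space M - ?I = W" by (auto simp: W_def)
  finally have p: "prob U = prob W" .
  have "finite (V - {a})" using insert.hyps by simp
  then obtain Y' where Y': "simple_function M Y'" "\<forall>\<omega>\<in>U. Y' \<omega> = a"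
    "AE \<omega> in M. \<omega> \<in> W \<longrightarrow> Y' \<omega> \<in> V - {a}" "\<forall>\<omega>. \<omega> \<notin> U \<and> \<omega> \<notin> W \<longrightarrow> Y' \<omega> = Y \<omega>"
    "\<forall>v. prob (Y' -` {v} \<inter> space M) = prob (Y -` {v} \<inter> space M)" "\<rho> Y' \<le> \<rho> Y"
    using rho_transport[OF _ UW dj p Y, of "V - {a}" a] by (auto simp: U_def W_def)
  have "\<rho> X \<le> \<rho> Y'"
  proof (rule insert.IH[OF Y'(1)])
    show "prob (Y' -` {v} \<inter> space M) = prob (X -` {v} \<inter> space M)" for v
      using Y'(5) law by simp
    show "AE \<omega> in M. X \<omega> = Y' \<omega> \<or> X \<omega> \<in> V \<and> Y' \<omega> \<in> V"
      using AE Y'(3) AE_space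
    proof eventually_elim
      case (elim \<omega>)
      consider "\<omega> \<in> U" | "\<omega> \<in> W" | "\<omega> \<notin> U" "\<omega> \<notin> W" by blast
      then show ?case
      proof cases
        case 1
        then show ?thesis using Y'(2) by (auto simp: U_def)
      next
        case 2
        then show ?thesis using elim by (auto simp: W_def)
      next
        case 3
        then have "Y' \<omega> = Y \<omega>" using Y'(4) by blast
        moreover have "X \<omega> = Y \<omega> \<or> X \<omega> \<noteq> a \<and> Y \<omega> \<noteq> a"
          using 3 elim(1,3) by (auto simp: U_def W_def)
        ultimately show ?thesis using elim(1) by auto
      qed
    qed
  qed
  then show ?case using Y'(6) by (rule order_trans)
qed

lemma rho_le_simple_law:
  assumes X: "simple_function M X" and Y: "simple_function M Y"
    and law: "\<And>v. prob (Y -` {v} \<inter> space M) = prob (X -` {v} \<inter> space M)"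
  shows "\<rho> X \<le> \<rho> Y"
proof (rule rho_le_of_simple_rearrangement[OF X _ Y law])
  show "finite (X ` space M \<union> Y ` space M)" using X Y by (simp add: simple_functionD(1))
  show "AE \<omega> in M. X \<omega> = Y \<omega> \<or>
      X \<omega> \<in> X ` space M \<union> Y ` space M \<and> Y \<omega> \<in> X ` space M \<union> Y ` space M"
    using AE_space by eventually_elim auto
qed

section \<open>From simple to integrable random variables\<close>

lemma rho_level_avg_discretise_le:
  assumes X: "integrable M X" and Y: "integrable M Y" and law: "distr M borel X = distr M borel Y"
  shows "\<rho> (level_avg M (\<lambda>\<omega>. discretise n (X \<omega>)) X) \<le> \<rho> (level_avg M (\<lambda>\<omega>. discretise n (Y \<omega>)) Y)"
proof (rule rho_le_simple_law)
  show "simple_function M (level_avg M (\<lambda>\<omega>. discretise n (X \<omega>)) X)"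
      "simple_function M (level_avg M (\<lambda>\<omega>. discretise n (Y \<omega>)) Y)"
    by (rule simple_level_avg[OF simple_discretise_comp[OF X]],
        rule simple_level_avg[OF simple_discretise_comp[OF Y]])
  fix v
  \<comment> \<open>The discretised average is a function of the value of \<open>X\<close>, built
    from the law alone. So the same Borel set \<open>D\<close> describes the level \<open>v\<close>
    for both \<open>X\<close> and \<open>Y\<close>.\<close>
  define D where "D = {x. set_avg (distr M borel X) (discretise n -` {discretise n x}) (\<lambda>x. x) = v}"
  have "D = discretise n -` {k. set_avg (distr M borel X) (discretise n -` {k}) (\<lambda>x. x) = v}"
    by (auto simp: D_def)
  then have D: "D \<in> sets borel" using vimage_discretise by simp
  have eq: "level_avg M (\<lambda>\<omega>. discretise n (Z \<omega>)) Z -` {v} \<inter> space M = Z -` D \<inter> space M"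
    if "integrable M Z" "distr M borel Z = distr M borel X" for Z
    using that by (auto simp: level_avg_discretise D_def)
  have "prob (Z -` D \<inter> space M) = measure (distr M borel Z) D" if "integrable M Z" for Z
    using that D by (simp add: measure_distr)
  then show "prob (level_avg M (\<lambda>\<omega>. discretise n (Y \<omega>)) Y -` {v} \<inter> space M) =
      prob (level_avg M (\<lambda>\<omega>. discretise n (X \<omega>)) X -` {v} \<inter> space M)"
    using X Y law eq[OF X] eq[OF Y] by simp
qed

text \<open>The discretised averages are not known to be dominated, so Fatou is not applied to them
  directly. With \<open>\<pi>\<close> fixed, convergence in the mean is enough for
  \<open>Fatou_cexp\<close>, and dilatation monotonicity then removes \<open>\<pi>\<close> from the
  approximants.\<close>

lemma rho_bar_le_liminf_discretise:
  assumes X: "integrable M X"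
  shows "rho_bar M \<rho> X \<le> liminf (\<lambda>n. \<rho> (level_avg M (\<lambda>\<omega>. discretise n (X \<omega>)) X))"
  unfolding rho_bar_def
proof (rule SUP_least)
  fix \<pi> assume \<pi>: "\<pi> \<in> finite_partitions M"
  define Z where "Z n = level_avg M (\<lambda>\<omega>. discretise n (X \<omega>)) X" for n
  have Z: "simple_function M (Z n)" for n
    unfolding Z_def by (rule simple_level_avg[OF simple_discretise_comp[OF X]])
  have "\<rho> (cexp_partition M \<pi> X) \<le> liminf (\<lambda>n. \<rho> (cexp_partition M \<pi> (Z n)))"
  proof (rule Fatou_cexp[OF \<pi> integrable_simple[OF Z] X])
    fix A assume "A \<in> \<pi>"
    then have A: "A \<in> sets M" by (rule finite_partitionsD(4)[OF \<pi>])
    show "(\<lambda>n. LINT \<omega>:A|M. Z n \<omega>) \<longlonglongrightarrow> (LINT \<omega>:A|M. X \<omega>)"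
    proof (rule LIM_zero_cancel, rule Lim_null_comparison)
      show "\<forall>\<^sub>F n in sequentially. norm ((LINT \<omega>:A|M. Z n \<omega>) - (LINT \<omega>:A|M. X \<omega>)) \<le> (\<integral>\<omega>. \<bar>Z n \<omega> - X \<omega>\<bar> \<partial>M)"
      proof (intro always_eventually allI)
        fix n
        have i: "integrable M (\<lambda>\<omega>. Z n \<omega> - X \<omega>)" using Z X by auto
        have "(LINT \<omega>:A|M. Z n \<omega>) - (LINT \<omega>:A|M. X \<omega>) = (LINT \<omega>:A|M. Z n \<omega> - X \<omega>)"
          using X A by (intro set_integral_diff(2)[symmetric] set_integrable_L1 integrable_simple[OF Z])
        also have "norm \<dots> \<le> (LINT \<omega>:A|M. \<bar>Z n \<omega> - X \<omega>\<bar>)"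
          using set_integral_norm_bound[OF set_integrable_L1[OF i A]] by simp
        also have "\<dots> \<le> (\<integral>\<omega>. \<bar>Z n \<omega> - X \<omega>\<bar> \<partial>M)"
          unfolding set_lebesgue_integral_def
          using i A integrable_mult_indicator[OF A integrable_abs[OF i]]
          by (intro integral_mono) (auto simp: indicator_def)
        finally show "norm ((LINT \<omega>:A|M. Z n \<omega>) - (LINT \<omega>:A|M. X \<omega>)) \<le> (\<integral>\<omega>. \<bar>Z n \<omega> - X \<omega>\<bar> \<partial>M)" .
      qed
    qed (unfold Z_def, rule level_avg_discretise_L1[OF X])
  qed
  also have "\<dots> \<le> liminf (\<lambda>n. \<rho> (Z n))"
  proof (intro Liminf_mono always_eventually allI)
    show "\<rho> (cexp_partition M \<pi> (Z n)) \<le> \<rho> (Z n)" for n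
      using dm simple_in_S[OF Z] \<pi> unfolding dilatation_monotone_def by blast
  qed
  finally show "\<rho> (cexp_partition M \<pi> X) \<le> liminf (\<lambda>n. \<rho> (level_avg M (\<lambda>\<omega>. discretise n (X \<omega>)) X))"
    unfolding Z_def .
qed

lemma rho_bar_law_invariant: "law_invariant M (L1 M) (rho_bar M \<rho>)"
proof -
  have "rho_bar M \<rho> X \<le> rho_bar M \<rho> Y"
    if X: "integrable M X" and Y: "integrable M Y" and law: "distr M borel X = distr M borel Y" for X Y
  proof -
    have "rho_bar M \<rho> X \<le> liminf (\<lambda>n. \<rho> (level_avg M (\<lambda>\<omega>. discretise n (X \<omega>)) X))"
      by (rule rho_bar_le_liminf_discretise[OF X])
    also have "\<dots> \<le> liminf (\<lambda>n::nat. rho_bar M \<rho> Y)"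
    proof (intro Liminf_mono always_eventually allI)
      show "\<rho> (level_avg M (\<lambda>\<omega>. discretise n (X \<omega>)) X) \<le> rho_bar M \<rho> Y" for n
        using rho_level_avg_discretise_le[OF X Y law]
          rho_bar_level_avg[OF simple_discretise_comp[OF Y] Y] by (rule order_trans)
    qed
    also have "\<dots> = rho_bar M \<rho> Y" by (simp add: Liminf_const)
    finally show ?thesis .
  qed
  then show ?thesis unfolding law_invariant_def L1_def by (simp add: antisym)
qed

end

theorem theorem4:
  fixes M :: "'a measure" and S :: "('a \<Rightarrow> real) set" and \<rho> :: "('a \<Rightarrow> real) \<Rightarrow> ereal"
  assumes "prob_space M" and "nonatomic M"
    and "L1_subset M S" and "simple_rvs M \<subseteq> S"
    and "functional_on M S \<rho>" and "\<forall>X\<in>S. \<rho> X \<noteq> -\<infinity>"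
    and "dilatation_monotone M S \<rho>" and "Fatou_property M S \<rho>"
  shows "(\<forall>X\<in>L1 M. rho_bar M \<rho> X \<noteq> -\<infinity>) \<and>
    dm_lsc_extension M S \<rho> (rho_bar M \<rho>) \<and>
    (\<forall>\<rho>'. dm_lsc_extension M S \<rho> \<rho>' \<longrightarrow> (\<forall>X\<in>L1 M. \<rho>' X = rho_bar M \<rho> X)) \<and>
    law_invariant M (L1 M) (rho_bar M \<rho>) \<and>
    (monotone_functional M S \<rho> \<longrightarrow> monotone_functional M (L1 M) (rho_bar M \<rho>)) \<and>
    (convex_functional S \<rho> \<longrightarrow> convex_functional (L1 M) (rho_bar M \<rho>)) \<and>
    (quasiconvex_functional S \<rho> \<longrightarrow> quasiconvex_functional (L1 M) (rho_bar M \<rho>)) \<and>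
    (cash_additive S \<rho> \<longrightarrow> cash_additive (L1 M) (rho_bar M \<rho>))"
proof -
  interpret dilatation_monotone_Fatou M S \<rho>
    using assms by (simp add: dilatation_monotone_Fatou_def dilatation_monotone_Fatou_axioms_def)
  show ?thesis
    using rho_bar_not_MInfty[OF assms(6)] rho_bar_extension dm_lsc_extension_unique
      rho_bar_law_invariant rho_bar_monotone rho_bar_convex rho_bar_quasiconvex rho_bar_cash_additive
    by blast
qed

end
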